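(* Let $J_3$ be the Flower snark on the $12$ vertices $x_0,x_1,x_{-1},y_0,y_1,y_{-1},z_0,z_1,z_{-1},v_0,v_1,v_{-1}$ whose $18$ edges are: $z_0v_0$, $z_0x_0$, $z_0y_0$, $v_0v_1$, $v_0v_{-1}$, $v_1v_{-1}$, $x_0x_1$, $x_0x_{-1}$, $y_0y_1$, $y_0y_{-1}$, $v_1z_1$, $v_{-1}z_{-1}$, $x_1z_1$, $y_1z_1$, $x_{-1}z_{-1}$, $y_{-1}z_{-1}$, $x_{-1}y_1$, $x_1y_{-1}$. Then $J_3$ is Class~$0$, i.e., its pebbling number is $\pi(J_3)=n(J_3)=12$.
   Context: A configuration $C$ on a graph $G$ assigns to each vertex $v$ a nonnegative integer $C(v)$ (number of pebbles). A pebbling move removes two pebbles from a vertex $v$ and places one pebble on a vertex adjacent to $v$. A configuration is $r$-solvable if some sequence of pebbling moves results in at least one pebble on the target vertex $r$. The pebbling number $\pi(G)$ is the minimum integer $t$ such that for every vertex $r$ of $G$, every configuration with $t$ pebbles in total is $r$-solvable. One always has $\pi(G)\ge n(G)$, the number of vertices, and $G$ is called Class~$0$ if $\pi(G)=n(G)$. The graph $J_3$ (also called Tietze's graph) is the Petersen graph with one vertex replaced by a triangle. *)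

theory Defs
  imports Main
begin

text \<open>A graph is given by a finite vertex set V and a symmetric irreflexive
adjacency relation E. A configuration is a function C :: 'a => nat, required
to vanish outside V.\<close>

definition is_config :: "'a set \<Rightarrow> ('a \<Rightarrow> nat) \<Rightarrow> bool" where
  "is_config V C \<longleftrightarrow> (\<forall>v. v \<notin> V \<longrightarrow> C v = 0)"

definition size_config :: "'a set \<Rightarrow> ('a \<Rightarrow> nat) \<Rightarrow> nat" where
  "size_config V C = (\<Sum>v\<in>V. C v)"

definition pebbling_move ::
  "'a set \<Rightarrow> ('a \<Rightarrow> 'a \<Rightarrow> bool) \<Rightarrow> ('a \<Rightarrow> nat) \<Rightarrow> ('a \<Rightarrow> nat) \<Rightarrow> bool" where
  "pebbling_move V E C C' \<longleftrightarrow>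
     (\<exists>v w. v \<in> V \<and> w \<in> V \<and> E v w \<and> 2 \<le> C v \<and>
            C' = C(v := C v - 2, w := C w + 1))"

definition solvable ::
  "'a set \<Rightarrow> ('a \<Rightarrow> 'a \<Rightarrow> bool) \<Rightarrow> ('a \<Rightarrow> nat) \<Rightarrow> 'a \<Rightarrow> bool" where
  "solvable V E C r \<longleftrightarrow>
     (\<exists>C'. (pebbling_move V E)\<^sup>*\<^sup>* C C' \<and> 1 \<le> C' r)"

definition pebbling_number :: "'a set \<Rightarrow> ('a \<Rightarrow> 'a \<Rightarrow> bool) \<Rightarrow> nat" where
  "pebbling_number V E =
     (LEAST t. \<forall>r\<in>V. \<forall>C. is_config V C \<and> size_config V C = t \<longrightarrow> solvable V E C r)"

datatype J3_vertex = X0 | X1 | Xm1 | Y0 | Y1 | Ym1 | Z0 | Z1 | Zm1 | V0 | V1 | Vm1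

definition J3_V :: "J3_vertex set" where
  "J3_V = {X0, X1, Xm1, Y0, Y1, Ym1, Z0, Z1, Zm1, V0, V1, Vm1}"

definition J3_edges :: "(J3_vertex \<times> J3_vertex) set" where
  "J3_edges = {(Z0,V0), (Z0,X0), (Z0,Y0), (V0,V1), (V0,Vm1), (V1,Vm1),
               (X0,X1), (X0,Xm1), (Y0,Y1), (Y0,Ym1), (V1,Z1), (Vm1,Zm1),
               (X1,Z1), (Y1,Z1), (Xm1,Zm1), (Ym1,Zm1), (Xm1,Y1), (X1,Ym1)}"

definition J3_adj :: "J3_vertex \<Rightarrow> J3_vertex \<Rightarrow> bool" where
  "J3_adj u v \<longleftrightarrow> (u, v) \<in> J3_edges \<or> (v, u) \<in> J3_edges"

end

theory Submission
  imports Defs "HOL-Library.Code_Binary_Nat"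
begin

text \<open>
  Fix a root \<open>r\<close> and give weights to the vertices of a tree rooted at \<open>r\<close> that at least double
  towards the root. In a configuration from which \<open>r\<close> cannot be reached, the weighted number of
  pebbles is at most the total weight. The bounds from trees of depth at most 5 alone leave some
  configurations with 12 pebbles on \<open>J\<^sub>3\<close>; but the bounds also hold after any pebbling moves, which
  yields further inequalities valid where the vertices concerned carry enough pebbles. Branching on
  the number of pebbles on single vertices, each case becomes contradictory as a linear combination
  of such inequalities. By symmetry only the roots \<open>v\<^sub>0\<close>, \<open>z\<^sub>0\<close> and \<open>x\<^sub>0\<close> have to be treated. Conversely,
  with fewer than 12 pebbles there may be at most one on each vertex and none on the root.
\<close>

subsection \<open>Weight functions\<close>

lemma solvable_step:
  assumes "v \<in> V" "w \<in> V" "E v w" "2 \<le> C v"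
    and "solvable V E (C(v := C v - 2, w := C w + 1)) r"
  shows "solvable V E C r"
proof -
  have "pebbling_move V E C (C(v := C v - 2, w := C w + 1))"
    unfolding pebbling_move_def using assms(1-4) by blast
  with assms(5) show ?thesis
    unfolding solvable_def by (meson converse_rtranclp_into_rtranclp)
qed

text \<open>Lost and gained weight are added on opposite sides, which avoids subtraction of
  naturals. With \<open>f\<close> constantly 1 this says that a move costs one pebble; with a
  weighting it controls the weighted count.\<close>

lemma sum_move:
  fixes f C :: "'a \<Rightarrow> nat"
  assumes "finite V" "v \<in> V" "w \<in> V" "v \<noteq> w" "2 \<le> C v"
  shows "(\<Sum>u\<in>V. f u * (C(v := C v - 2, w := C w + 1)) u) + 2 * f v = (\<Sum>u\<in>V. f u * C u) + f w"
proof -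
  let ?D = "C(v := C v - 2, w := C w + 1)"
  have split: "sum g V = g v + g w + sum g (V - {v} - {w})" for g :: "'a \<Rightarrow> nat"
    using assms(1-4) sum.remove[of V v g] sum.remove[of "V - {v}" w g] by simp
  have rest: "(\<Sum>u\<in>V - {v} - {w}. f u * ?D u) = (\<Sum>u\<in>V - {v} - {w}. f u * C u)"
    by (rule sum.cong) auto
  have "f v * (C v - 2) + 2 * f v = f v * C v"
    using assms(5) by (simp add: diff_mult_distrib2)
  then show ?thesis
    using assms(4) by (simp add: split rest)
qed

text \<open>The tree stays implicit: each vertex of positive weight only needs some parent
  \<open>p\<close>. Weights at least double along parents, so on a finite \<open>V\<close> following
  parents must end at \<open>r\<close>. An edge into \<open>r\<close> carries no condition, since a
  pebble arriving there already solves the configuration.\<close>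

definition weighting :: "'a set \<Rightarrow> ('a \<Rightarrow> 'a \<Rightarrow> bool) \<Rightarrow> 'a \<Rightarrow> ('a \<Rightarrow> nat) \<Rightarrow> bool" where
  "weighting V E r f \<longleftrightarrow>
     (\<forall>v\<in>V. 0 < f v \<longrightarrow> (\<exists>p\<in>V. E v p \<and> (p = r \<or> 2 * f v \<le> f p)))"

text \<open>Were the bound violated, some vertex of positive weight would carry two pebbles; moving
  them towards the root keeps the bound violated but uses up a pebble.\<close>

theorem weight_bound:
  assumes "finite V" and irrefl: "\<And>v. \<not> E v v" and wf: "weighting V E r f"
    and "\<not> solvable V E C r"
  shows "(\<Sum>v\<in>V. f v * C v) \<le> (\<Sum>v\<in>V. f v)"
proof (rule ccontr)
  assume "\<not> ?thesis"
  then have "(\<Sum>v\<in>V. f v) < (\<Sum>v\<in>V. f v * C v)"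
    by simp
  then have "solvable V E C r"
  \<comment> \<open>Each move lowers the number of pebbles by one, so this number is the induction
    measure.\<close>
  proof (induction "size_config V C" arbitrary: C rule: less_induct)
    case less
    \<comment> \<open>If \<open>f v * C v \<le> f v\<close> held at every vertex, summation would
      give the bound.\<close>
    obtain v where v: "v \<in> V" "f v < f v * C v"
      using sum_mono[of V "\<lambda>v. f v * C v" f] less.prems by (meson leD leI)
    then have "0 < f v" "2 \<le> C v"
      by (auto simp: Suc_le_eq numeral_2_eq_2 intro: gr0I)
    then obtain p where p: "p \<in> V" "E v p" "p = r \<or> 2 * f v \<le> f p"
      using wf v(1) unfolding weighting_def by blast
    then have "v \<noteq> p"
      using irrefl by blast
    let ?D = "C(v := C v - 2, p := C p + 1)"
    show ?case
    proof (rule solvable_step[of v V p E C r, OF v(1) p(1,2) \<open>2 \<le> C v\<close>], cases "p = r")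
      case True
      then have "1 \<le> ?D r"
        by simp
      then show "solvable V E ?D r"
        unfolding solvable_def by blast
    next
      case False
      note sum_move = sum_move[where v = v and w = p and C = C, OF \<open>finite V\<close> v(1) p(1) \<open>v \<noteq> p\<close> \<open>2 \<le> C v\<close>]
      have "size_config V ?D < size_config V C"
        using sum_move[of "\<lambda>_. 1"] unfolding size_config_def by simp
      \<comment> \<open>The weighted count changes by \<open>f p - 2 * f v\<close>, which is
        nonnegative by the doubling condition because \<open>p\<close> is not the root.\<close>
      moreover have "(\<Sum>v\<in>V. f v) < (\<Sum>v\<in>V. f v * ?D v)"
        using sum_move[of f] False p(3) less.prems by linarith
      ultimately show "solvable V E ?D r"
        by (rule less.hyps)
    qed
  qed
  with assms(4) show False by simp
qed

subsection \<open>Certificates\<close>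

text \<open>A rooted tree with weights is a list of entries (vertex, (parent, weight)).\<close>

type_synonym 'a tree = "('a \<times> 'a \<times> nat) list"

definition tree_weight :: "'a tree \<Rightarrow> 'a \<Rightarrow> nat" where
  "tree_weight t v = (case map_of t v of None \<Rightarrow> 0 | Some (p, k) \<Rightarrow> k)"

text \<open>Only local conditions are tested, so that the check is a single pass over the list.
  Unlisted vertices have weight 0, hence the parent of an entry of positive weight is the root or is
  listed itself.\<close>

definition valid_tree :: "('a \<Rightarrow> 'a \<Rightarrow> bool) \<Rightarrow> 'a \<Rightarrow> 'a tree \<Rightarrow> bool" where
  "valid_tree E r t \<longleftrightarrow>
     list_all (\<lambda>(v, p, k). E v p \<and> (p = r \<or> 2 * k \<le> tree_weight t p)) t"

text \<open>A positive weight can only come from an entry for that vertex, and the parent stored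
  there is the required \<open>p\<close>.\<close>

lemma weighting_tree_weight:
  assumes "valid_tree E r t" and "\<And>v w. E v w \<Longrightarrow> w \<in> V"
  shows "weighting V E r (tree_weight t)"
  unfolding weighting_def
proof (intro ballI impI)
  fix v assume "0 < tree_weight t v"
  then obtain p where "map_of t v = Some (p, tree_weight t v)"
    unfolding tree_weight_def by (auto split: option.splits)
  then have "(v, p, tree_weight t v) \<in> set t"
    by (rule map_of_SomeD)
  then show "\<exists>p\<in>V. E v p \<and> (p = r \<or> 2 * tree_weight t v \<le> tree_weight t p)"
    using assms unfolding valid_tree_def list_all_iff by fastforce
qed

section \<open>Move sequences paid for by guaranteed pebbles\<close>

text \<open>\<open>L\<close> stands for pebbles known to be present, not for the whole
  configuration. The result \<open>None\<close> marks a sequence containing an illegal move or one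
  that these pebbles do not pay for.\<close>

fun apply_moves :: "('a \<Rightarrow> 'a \<Rightarrow> bool) \<Rightarrow> ('a \<times> 'a) list \<Rightarrow> ('a \<Rightarrow> nat) \<Rightarrow> ('a \<Rightarrow> nat) option" where
  "apply_moves E [] L = Some L"
| "apply_moves E ((v, w) # ms) L =
     (if E v w \<and> v \<noteq> w \<and> 2 \<le> L v then apply_moves E ms (L(v := L v - 2, w := L w + 1)) else None)"

text \<open>The moves are paid for by \<open>L\<close> alone, so they remain legal next to the extra
  pebbles \<open>R\<close>, which stay in place. A solution found after the moves would extend
  backwards to a solution from the start.\<close>

lemma apply_moves_unsolvable:
  assumes "apply_moves E ms L = Some L'" and E: "\<And>v w. E v w \<Longrightarrow> v \<in> V \<and> w \<in> V"
    and "\<not> solvable V E (\<lambda>v. L v + R v) r"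
  shows "\<not> solvable V E (\<lambda>v. L' v + R v) r"
  using assms(1,3)
proof (induction ms arbitrary: L)
  case (Cons m ms)
  obtain v w where m: "m = (v, w)"
    by fastforce
  let ?L = "L(v := L v - 2, w := L w + 1)" and ?C = "\<lambda>v. L v + R v"
  have vw: "E v w" "v \<noteq> w" "2 \<le> L v" and "apply_moves E ms ?L = Some L'"
    using Cons.prems(1) by (auto simp: m split: if_splits)
  \<comment> \<open>Since \<open>L v\<close> is at least 2, subtracting 2 commutes with adding
    \<open>R v\<close>.\<close>
  moreover have "?C(v := ?C v - 2, w := ?C w + 1) = (\<lambda>v. ?L v + R v)"
    using vw by auto
  then have "\<not> solvable V E (\<lambda>v. ?L v + R v) r"
    using Cons.prems(2) solvable_step[of v V w E ?C r] vw E by fastforce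
  ultimately show ?case
    using Cons.IH by blast
qed simp

text \<open>A certificate splits a box of configurations until every box is refuted by a combination
  of weight bounds: a triple (c, ms, t) in a leaf stands for c times the bound of the tree t after
  the moves ms, which use only the pebbles guaranteed by the lower corner of the box, and the
  leaf subtracts this combination from m times the equation for the number of pebbles.\<close>

datatype 'a cert =
    Split 'a nat "'a cert" "'a cert"
  | Leaf nat "(nat \<times> ('a \<times> 'a) list \<times> 'a tree) list"

text \<open>To read the leaf condition, put \<open>R = C - lo\<close> and let \<open>a v\<close> be
  the coefficient of \<open>v\<close> in the combination of bounds. The bounds limit the sum of
  \<open>a v * R v\<close> from above, while \<open>m\<close> times the pebble count limits it from
  below once the part not covered by \<open>a v\<close> is estimated by the width of the box. The
  condition says that the two limits clash, rearranged so that large subtractions disappear.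
  Truncation in \<open>m - a v\<close> is intended: a coefficient that reaches \<open>m\<close>
  leaves nothing to estimate. With \<open>m = 0\<close> the bounds contradict the lower corner by
  themselves.\<close>

fun refutes ::
  "('a \<Rightarrow> 'a \<Rightarrow> bool) \<Rightarrow> 'a list \<Rightarrow> 'a \<Rightarrow> nat \<Rightarrow> ('a \<Rightarrow> nat) \<Rightarrow> ('a \<Rightarrow> nat) \<Rightarrow> 'a cert \<Rightarrow> bool" where
  "refutes E vs r n lo hi (Split v k c d) \<longleftrightarrow>
     refutes E vs r n lo (hi(v := k)) c \<and> refutes E vs r n (lo(v := Suc k)) hi d"
| "refutes E vs r n lo hi (Leaf m xs) \<longleftrightarrow>
     list_all (\<lambda>(c, ms, t). valid_tree E r t \<and> apply_moves E ms lo \<noteq> None) xs \<and>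
     (\<Sum>(c, ms, t)\<leftarrow>xs. c * (\<Sum>v\<leftarrow>vs. tree_weight t v)) +
     (\<Sum>v\<leftarrow>vs. (m - (\<Sum>(c, ms, t)\<leftarrow>xs. c * tree_weight t v)) * (hi v - lo v))
     < m * (n - (\<Sum>v\<leftarrow>vs. lo v)) +
       (\<Sum>(c, ms, t)\<leftarrow>xs. c * (\<Sum>v\<leftarrow>vs. tree_weight t v * the (apply_moves E ms lo) v))"

lemma sum_list_sum_swap:
  fixes g :: "'a \<Rightarrow> 'b \<Rightarrow> nat"
  shows "(\<Sum>x\<leftarrow>xs. \<Sum>v\<in>V. g x v) = (\<Sum>v\<in>V. \<Sum>x\<leftarrow>xs. g x v)"
  by (induction xs) (simp_all add: sum.distrib)

section \<open>Soundness of certificates\<close>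

text \<open>Induction on the certificate. At a split the configuration lies in one of the two
  smaller boxes. At a leaf, unsolvability would make all listed bounds hold at once, and their
  combination is arithmetically impossible.\<close>

lemma refutes_sound:
  assumes "refutes E vs r n lo hi c" "distinct vs" "set vs = V"
    and irrefl: "\<And>v. \<not> E v v" and E: "\<And>v w. E v w \<Longrightarrow> v \<in> V \<and> w \<in> V"
    and "\<And>v. lo v \<le> C v" "\<And>v. v \<in> V \<Longrightarrow> C v \<le> hi v" "size_config V C = n"
  shows "solvable V E C r"
  using assms(1,6,7)
proof (induction c arbitrary: lo hi)
  case (Split v k c d)
  then have c: "refutes E vs r n lo (hi(v := k)) c" and d: "refutes E vs r n (lo(v := Suc k)) hi d"
    by simp_all
  show ?case
  proof (cases "C v \<le> k")
    case True
    with Split.prems show ?thesis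
      by (intro Split.IH(1)[OF c]) auto
  next
    case False
    with Split.prems show ?thesis
      by (intro Split.IH(2)[OF d]) auto
  qed
next
  case (Leaf m xs)
  have fin: "finite V"
    using assms(3) by auto
  have sum_vs: "(\<Sum>v\<leftarrow>vs. g v) = sum g V" for g :: "'a \<Rightarrow> nat"
    using assms(2,3) by (simp add: sum_list_distinct_conv_sum_set)
  \<comment> \<open>\<open>R\<close> is the surplus over the lower corner; the moves of the
    certificate touch only the pebbles in \<open>lo\<close>.\<close>
  define R where "R v = C v - lo v" for v
  have C: "C = (\<lambda>v. lo v + R v)"
    using Leaf.prems(2) by (auto simp: R_def)
  define a where "a v = (\<Sum>(c, ms, t)\<leftarrow>xs. c * tree_weight t v)" for v
  let ?L = "\<lambda>ms. the (apply_moves E ms lo)"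
  show ?case
  proof (rule ccontr)
    assume unsolvable: "\<not> solvable V E C r"
    have bound: "c * (\<Sum>v\<in>V. tree_weight t v * ?L ms v) + (\<Sum>v\<in>V. c * tree_weight t v * R v)
        \<le> c * (\<Sum>v\<in>V. tree_weight t v)" if x: "(c, ms, t) \<in> set xs" for c ms t
    proof -
      have "valid_tree E r t" "apply_moves E ms lo = Some (?L ms)"
        using Leaf.prems(1) x by (auto simp: list_all_iff)
      \<comment> \<open>After the moves the configuration is \<open>?L ms\<close> plus the surplus.
        It is still unsolvable, so the weight bound of the tree applies to it.\<close>
      then have "(\<Sum>v\<in>V. tree_weight t v * (?L ms v + R v)) \<le> (\<Sum>v\<in>V. tree_weight t v)"
        using unsolvable E unfolding C
        by (intro weight_bound[OF fin irrefl weighting_tree_weight]) (auto dest: apply_moves_unsolvable)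
      then have "c * (\<Sum>v\<in>V. tree_weight t v * (?L ms v + R v)) \<le> c * (\<Sum>v\<in>V. tree_weight t v)"
        by (rule mult_le_mono2)
      then show ?thesis
        by (simp add: distrib_left sum.distrib sum_distrib_left mult.assoc)
    qed
    \<comment> \<open>Adding the bounds with their multiplicities and exchanging the two sums
      collects the surplus terms into the coefficients \<open>a v\<close>.\<close>
    have "(\<Sum>(c, ms, t)\<leftarrow>xs. c * (\<Sum>v\<in>V. tree_weight t v * ?L ms v)) + (\<Sum>v\<in>V. a v * R v)
        = (\<Sum>(c, ms, t)\<leftarrow>xs. c * (\<Sum>v\<in>V. tree_weight t v * ?L ms v) + (\<Sum>v\<in>V. c * tree_weight t v * R v))"
      by (simp add: a_def sum_list_addf split_def flip: sum_list_sum_swap sum_list_mult_const)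
    also have "\<dots> \<le> (\<Sum>(c, ms, t)\<leftarrow>xs. c * (\<Sum>v\<in>V. tree_weight t v))"
      using bound by (intro sum_list_mono) auto
    finally have combined: "(\<Sum>(c, ms, t)\<leftarrow>xs. c * (\<Sum>v\<in>V. tree_weight t v * ?L ms v)) + (\<Sum>v\<in>V. a v * R v)
        \<le> (\<Sum>(c, ms, t)\<leftarrow>xs. c * (\<Sum>v\<in>V. tree_weight t v))" .
    have "n = sum lo V + sum R V"
      using assms(8) by (simp add: C size_config_def sum.distrib)
    then have "m * (n - sum lo V) = (\<Sum>v\<in>V. m * R v)"
      by (simp add: sum_distrib_left)
    \<comment> \<open>Vertex by vertex, the combination covers \<open>a v\<close> of the factor
      \<open>m\<close>; the remainder is estimated by the width of the box.\<close>
    also have "\<dots> \<le> (\<Sum>v\<in>V. a v * R v + (m - a v) * (hi v - lo v))"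
    proof (rule sum_mono)
      fix v assume "v \<in> V"
      then have "R v \<le> hi v - lo v"
        using Leaf.prems(3) by (simp add: R_def diff_le_mono)
      \<comment> \<open>With truncated subtraction, \<open>m \<le> a v + (m - a v)\<close> holds
        whether or not \<open>a v\<close> exceeds \<open>m\<close>.\<close>
      have "m * R v \<le> (a v + (m - a v)) * R v"
        by (intro mult_le_mono1) simp
      also have "\<dots> \<le> a v * R v + (m - a v) * (hi v - lo v)"
        using \<open>R v \<le> hi v - lo v\<close> by (simp add: distrib_right)
      finally show "m * R v \<le> a v * R v + (m - a v) * (hi v - lo v)" .
    qed
    finally show False
      using Leaf.prems(1) combined by (simp add: sum_vs sum.distrib flip: a_def)
  qed
qed

text \<open>The initial box loses nothing: no vertex carries more than all \<open>n\<close> pebbles,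
  and the upper limit 0 at \<open>r\<close> is justified because a pebble on \<open>r\<close> is
  already a solution without any move.\<close>

corollary refutes_imp_solvable:
  assumes "refutes E vs r n (\<lambda>_. 0) ((\<lambda>_. n)(r := 0)) c" "distinct vs" "set vs = V"
    and "\<And>v. \<not> E v v" "\<And>v w. E v w \<Longrightarrow> v \<in> V \<and> w \<in> V"
    and "size_config V C = n"
  shows "solvable V E C r"
proof (cases "C r = 0")
  case True
  have "C v \<le> n" if "v \<in> V" for v
    using that assms(3,6) member_le_sum[of v V C] by (auto simp: size_config_def)
  then show ?thesis
    using assms True by (intro refutes_sound[OF assms(1)]) auto
next
  case False
  then show ?thesis
    by (auto simp: solvable_def Suc_le_eq intro!: exI[of _ C])
qed

subsection \<open>Lower bound and symmetry\<close>

text \<open>Put one pebble on each of \<open>t\<close> vertices other than \<open>r\<close>. No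
  vertex has the two pebbles that a move requires.\<close>

lemma unsolvable_of_less_card:
  assumes "finite V" "r \<in> V" "t < card V"
  obtains C where "is_config V C" "size_config V C = t" "\<not> solvable V E C r"
proof -
  have "t \<le> card (V - {r})"
    using assms by simp
  then obtain S where S: "S \<subseteq> V - {r}" "card S = t"
    by (meson obtain_subset_with_card_n)
  define C :: "'a \<Rightarrow> nat" where "C v = (if v \<in> S then 1 else 0)" for v
  have "C r = 0"
    using S(1) by (auto simp: C_def)
  have "\<not> pebbling_move V E C C'" for C'
    by (auto simp: pebbling_move_def C_def)
  \<comment> \<open>Without a first move only \<open>C\<close> itself is reachable, and it has no
    pebble on \<open>r\<close>.\<close>
  then have "\<not> solvable V E C r"
    using \<open>C r = 0\<close> unfolding solvable_def by (metis converse_rtranclpE not_one_le_zero)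
  moreover have "is_config V C"
    using S(1) by (auto simp: is_config_def C_def)
  moreover have "size_config V C = t"
    using S(2) assms(1) Int_absorb1[of S V] S(1) by (simp add: size_config_def C_def sum.If_cases subset_Diff_insert)
  ultimately show thesis
    using that by blast
qed

section \<open>Transport of solutions along automorphisms\<close>

text \<open>\<open>C \<circ> \<phi>\<close> places on \<open>v\<close> the pebbles that
  \<open>C\<close> has on \<open>\<phi> v\<close>. A move from \<open>v\<close> to \<open>w\<close>
  there is mirrored by the move from \<open>\<phi> v\<close> to \<open>\<phi> w\<close> in
  \<open>C\<close>, so a whole solution can be copied.\<close>

lemma solvable_automorphism:
  assumes "inj \<phi>" "\<phi> ` V \<subseteq> V" "\<And>v w. E v w \<Longrightarrow> E (\<phi> v) (\<phi> w)"
    and "solvable V E (C \<circ> \<phi>) r"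
  shows "solvable V E C (\<phi> r)"
proof -
  obtain D where D: "(pebbling_move V E)\<^sup>*\<^sup>* (C \<circ> \<phi>) D" "1 \<le> D r"
    using assms(4) unfolding solvable_def by blast
  from D(1) have "\<exists>C'. (pebbling_move V E)\<^sup>*\<^sup>* C C' \<and> D = C' \<circ> \<phi>"
  proof induction
    case (step D D')
    then obtain C' where C': "(pebbling_move V E)\<^sup>*\<^sup>* C C'" and D: "D = C' \<circ> \<phi>"
      by blast
    obtain v w where vw: "v \<in> V" "w \<in> V" "E v w" "2 \<le> C' (\<phi> v)"
      and D': "D' = D(v := D v - 2, w := D w + 1)"
      using step.hyps(2) unfolding pebbling_move_def D by auto
    let ?C = "C'(\<phi> v := C' (\<phi> v) - 2, \<phi> w := C' (\<phi> w) + 1)"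
    have "pebbling_move V E C' ?C"
      unfolding pebbling_move_def using vw assms(2,3) by blast
    \<comment> \<open>Injectivity ensures that changing the values at \<open>\<phi> v\<close> and
      \<open>\<phi> w\<close> affects the pullback at \<open>v\<close> and \<open>w\<close>
      only.\<close>
    moreover have "D' = ?C \<circ> \<phi>"
      using \<open>inj \<phi>\<close> unfolding D' D by (auto simp: fun_eq_iff inj_eq)
    ultimately show ?case
      using rtranclp.rtrancl_into_rtrancl[OF C'] by blast
  qed auto
  then show ?thesis
    using D(2) unfolding solvable_def by auto
qed

section \<open>The graph \<open>J3\<close> as finite data and its rotation\<close>

text \<open>A fixed enumeration of the vertices makes the sums in \<open>refutes\<close>
  computable.\<close>

definition J3_list :: "J3_vertex list" where
  "J3_list = [X0, X1, Xm1, Y0, Y1, Ym1, Z0, Z1, Zm1, V0, V1, Vm1]"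

lemma J3_list: "distinct J3_list" "set J3_list = J3_V"
  by (simp_all add: J3_list_def J3_V_def)

text \<open>The vertices are exactly the constructors of the datatype, so later membership
  conditions become trivial.\<close>

lemma J3_V_UNIV: "J3_V = UNIV"
proof -
  have "v \<in> J3_V" for v
    by (cases v) (simp_all add: J3_V_def)
  then show ?thesis by blast
qed

lemma card_J3_V: "card J3_V = 12"
  by (simp add: J3_V_def)

lemma J3_adj_irrefl: "\<not> J3_adj v v"
  by (cases v) (simp_all add: J3_adj_def J3_edges_def)

text \<open>The six vertices \<open>x\<^sub>i\<close>, \<open>y\<^sub>i\<close> form a hexagon; its rotation by one step extends to an
  automorphism with orbits \<open>{x\<^sub>i, y\<^sub>i}\<close>, \<open>{z\<^sub>i}\<close> and \<open>{v\<^sub>i}\<close>.\<close>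

fun rot :: "J3_vertex \<Rightarrow> J3_vertex" where
  "rot X0 = X1" | "rot X1 = Ym1" | "rot Ym1 = Y0" | "rot Y0 = Y1" | "rot Y1 = Xm1" | "rot Xm1 = X0"
| "rot Z0 = Z1" | "rot Z1 = Zm1" | "rot Zm1 = Z0"
| "rot V0 = V1" | "rot V1 = Vm1" | "rot Vm1 = V0"

lemma inj_rot: "inj rot"
proof (rule injI)
  show "u = v" if "rot u = rot v" for u v
    using that by (cases u; cases v) simp_all
qed

lemma J3_adj_rot: "J3_adj u v \<Longrightarrow> J3_adj (rot u) (rot v)"
  by (cases u; cases v) (simp_all add: J3_adj_def J3_edges_def)

text \<open>Passes from one root to the next in its orbit: the assumption is applied to
  \<open>C \<circ> rot\<close>, which has as many pebbles as \<open>C\<close> because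
  \<open>rot\<close> permutes the vertices.\<close>

lemma J3_solvable_rot:
  assumes "\<And>C. size_config J3_V C = n \<Longrightarrow> solvable J3_V J3_adj C r"
    and "size_config J3_V C = n"
  shows "solvable J3_V J3_adj C (rot r)"
proof (rule solvable_automorphism[where \<phi> = rot])
  have "rot ` J3_V = J3_V"
    by (auto simp: J3_V_def)
  then have "size_config J3_V (C \<circ> rot) = n"
    using assms(2) sum.reindex[of rot J3_V C] inj_rot
    by (simp add: size_config_def inj_on_subset[OF inj_rot])
  then show "solvable J3_V J3_adj (C \<circ> rot) r"
    by (rule assms(1))
qed (simp_all add: J3_V_UNIV inj_rot J3_adj_rot)

subsection \<open>The three orbits of roots\<close>

text \<open>The certificates were found by branch and bound over the linear programme given by all
  trees of depth at most 5 and all sequences of at most 3 moves.\<close>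

definition cert_V0 :: "J3_vertex cert" where
  "cert_V0 =
   Split Zm1 2
   (Split X0 1
    (Split Y0 1
     (Split Z0 0
      (Split Z1 2
       (Split Vm1 1
        (Split Xm1 0
         (Split X0 0
          (Leaf 21 [
            (1, [], [(V1, V0, 8), (Z1, V1, 4), (X1, Z1, 2), (Y1, Z1, 2), (Ym1, X1, 1)]),
            (2, [], [(Vm1, V0, 8), (Zm1, Vm1, 4), (Xm1, Zm1, 2), (Ym1, Zm1, 2), (X1, Ym1, 1), (Y1, Xm1, 1)]),
            (1, [], [(Z0, V0, 8), (Y0, Z0, 4), (Y1, Y0, 2), (Ym1, Y0, 2), (X1, Ym1, 1)]),
            (3, [], [(Z0, V0, 8), (X0, Z0, 4), (Y0, Z0, 4), (X1, X0, 2), (Y1, Y0, 2), (Ym1, Y0, 2), (Zm1, Ym1, 1)]),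
            (1, [], [(Vm1, V0, 16), (Zm1, Vm1, 8), (Ym1, Zm1, 4), (X1, Ym1, 2), (Y0, Ym1, 2), (Y1, Y0, 1), (Z1, X1, 1)]),
            (2, [], [(V1, V0, 16), (Z1, V1, 8), (X1, Z1, 4), (Y1, Z1, 4), (Y0, Y1, 2), (Ym1, X1, 2), (Zm1, Ym1, 1)])])
          (Split X1 0
           (Leaf 10 [
             (2, [], [(Z0, V0, 8), (Y0, Z0, 4), (Y1, Y0, 2), (Ym1, Y0, 2), (Z1, Y1, 1), (Zm1, Ym1, 1)]),
             (1, [], [(V1, V0, 16), (Z1, V1, 8), (X1, Z1, 4), (Y1, Z1, 4), (X0, X1, 2), (Ym1, X1, 2), (Zm1, Ym1, 1)]),
             (1, [], [(Vm1, V0, 16), (Zm1, Vm1, 8), (Xm1, Zm1, 4), (Ym1, Zm1, 4), (X0, Xm1, 2), (Y1, Xm1, 2), (Z1, Y1, 1)])])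
           (Split Ym1 1
            (Leaf 24 [
              (1, [], [(Vm1, V0, 8), (Zm1, Vm1, 4), (Xm1, Zm1, 2), (Ym1, Zm1, 2), (X1, Ym1, 1), (Y1, Xm1, 1)]),
              (3, [], [(V1, V0, 16), (Z1, V1, 8), (X1, Z1, 4), (Y1, Z1, 4), (X0, X1, 2), (Ym1, X1, 2), (Zm1, Ym1, 1)]),
              (5, [], [(Z0, V0, 8), (X0, Z0, 4), (Y0, Z0, 4), (X1, X0, 2), (Y1, Y0, 2), (Ym1, Y0, 2), (Zm1, Ym1, 1)]),
              (1, [], [(Vm1, V0, 16), (Zm1, Vm1, 8), (Ym1, Zm1, 4), (X1, Ym1, 2), (Y0, Ym1, 2), (Y1, Y0, 1), (Z1, X1, 1)])])
            (Leaf 42 [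
              (1, [], [(Vm1, V0, 8), (Zm1, Vm1, 4), (Xm1, Zm1, 2), (Ym1, Zm1, 2), (X1, Ym1, 1), (Y1, Xm1, 1)]),
              (5, [], [(V1, V0, 16), (Z1, V1, 8), (X1, Z1, 4), (Y1, Z1, 4), (X0, X1, 2), (Ym1, X1, 2), (Zm1, Ym1, 1)]),
              (8, [], [(Z0, V0, 8), (X0, Z0, 4), (Y0, Z0, 4), (X1, X0, 2), (Y1, Y0, 2), (Ym1, Y0, 2), (Zm1, Ym1, 1)]),
              (3, [], [(Vm1, V0, 16), (Zm1, Vm1, 8), (Ym1, Zm1, 4), (X1, Ym1, 2), (Y0, Ym1, 2), (Y1, Y0, 1), (Z1, X1, 1)]),
              (1, [(Ym1, X1), (X1, X0), (X0, Z0)], [(Z0, V0, 8), (Y0, Z0, 4), (Y1, Y0, 2), (Ym1, Y0, 2), (Zm1, Ym1, 1)])]))))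
         (Split Xm1 5
          (Split X1 0
           (Split Xm1 1
            (Split X0 0
             (Leaf 10 [
               (2, [], [(Vm1, V0, 8), (Zm1, Vm1, 4), (Xm1, Zm1, 2), (Ym1, Zm1, 2), (Y1, Xm1, 1)]),
               (2, [], [(Z0, V0, 8), (Y0, Z0, 4), (Y1, Y0, 2), (Ym1, Y0, 2), (Z1, Y1, 1), (Zm1, Ym1, 1)]),
               (1, [], [(V1, V0, 16), (Z1, V1, 8), (X1, Z1, 4), (Y1, Z1, 4), (Xm1, Y1, 2), (Ym1, X1, 2), (Zm1, Xm1, 1)])])
             (Split Y1 1
              (Leaf 24 [
                (1, [], [(V1, V0, 8), (Z1, V1, 4), (X1, Z1, 2), (Y1, Z1, 2), (Ym1, X1, 1)]),
                (3, [], [(Vm1, V0, 16), (Zm1, Vm1, 8), (Xm1, Zm1, 4), (Ym1, Zm1, 4), (X0, Xm1, 2), (Y1, Xm1, 2), (Z1, Y1, 1)]),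
                (5, [], [(Z0, V0, 8), (X0, Z0, 4), (Y0, Z0, 4), (Xm1, X0, 2), (Y1, Y0, 2), (Ym1, Y0, 2), (Z1, Y1, 1)]),
                (1, [], [(V1, V0, 16), (Z1, V1, 8), (Y1, Z1, 4), (Xm1, Y1, 2), (Y0, Y1, 2), (X0, Xm1, 1), (Ym1, Y0, 1), (Zm1, Xm1, 1)])])
              (Leaf 12 [
                (1, [], [(V1, V0, 16), (Z1, V1, 8), (Y1, Z1, 4), (Xm1, Y1, 2), (Y0, Y1, 2), (X0, Xm1, 1), (Ym1, Y0, 1), (Zm1, Xm1, 1)]),
                (1, [], [(V1, V0, 16), (Z1, V1, 8), (Y1, Z1, 4), (Xm1, Y1, 2), (Zm1, Xm1, 1)]),
                (5, [(Y1, Xm1), (Xm1, Zm1)], [(Vm1, V0, 4), (Zm1, Vm1, 2), (Ym1, Zm1, 1)]),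
                (6, [(Y1, Xm1), (Xm1, X0), (X0, Z0)], [(Z0, V0, 4), (Y0, Z0, 2), (Y1, Y0, 1), (Ym1, Y0, 1)])])))
            (Leaf 34 [
              (2, [], [(Vm1, V0, 8), (Zm1, Vm1, 4), (Xm1, Zm1, 2), (Ym1, Zm1, 2), (Y1, Xm1, 1)]),
              (1, [], [(Vm1, V0, 16), (Zm1, Vm1, 8), (Xm1, Zm1, 4), (Ym1, Zm1, 4), (Y0, Ym1, 2), (Y1, Xm1, 2), (Z1, Y1, 1)]),
              (2, [], [(Vm1, V0, 16), (Zm1, Vm1, 8), (Xm1, Zm1, 4), (Ym1, Zm1, 4), (X0, Xm1, 2), (Y1, Xm1, 2), (Z1, Y1, 1)]),
              (7, [], [(Z0, V0, 8), (X0, Z0, 4), (Y0, Z0, 4), (Xm1, X0, 2), (Y1, Y0, 2), (Ym1, Y0, 2), (Z1, Y1, 1)]),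
              (2, [], [(V1, V0, 16), (Z1, V1, 8), (Y1, Z1, 4), (Xm1, Y1, 2), (Y0, Y1, 2), (X0, Xm1, 1), (Ym1, Y0, 1), (Zm1, Xm1, 1)]),
              (1, [(Xm1, Y1)], [(V1, V0, 16), (Z1, V1, 8), (X1, Z1, 4), (Y1, Z1, 4), (Ym1, X1, 2), (Zm1, Ym1, 1)])]))
           (Split X1 5
            (Split Y1 0
             (Split X0 0
              (Split X1 3
               (Leaf 17 [
                 (3, [], [(V1, V0, 8), (Z1, V1, 4), (X1, Z1, 2), (Y1, Z1, 2), (Xm1, Y1, 1), (Ym1, X1, 1)]),
                 (3, [], [(Z0, V0, 8), (X0, Z0, 4), (Y0, Z0, 4), (X1, X0, 2), (Xm1, X0, 2), (Ym1, Y0, 2), (Z1, X1, 1)]),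
                 (2, [], [(Vm1, V0, 16), (Zm1, Vm1, 8), (Xm1, Zm1, 4), (Ym1, Zm1, 4), (X1, Ym1, 2), (Y0, Ym1, 2), (Z1, X1, 1)])])
               (Leaf 16 [
                 (4, [], [(V1, V0, 4), (Z1, V1, 2), (X1, Z1, 1)]),
                 (3, [], [(Vm1, V0, 8), (Zm1, Vm1, 4), (Xm1, Zm1, 2), (Ym1, Zm1, 2), (X1, Ym1, 1)]),
                 (2, [], [(V1, V0, 8), (Z1, V1, 4), (X1, Z1, 2), (Y1, Z1, 2), (Xm1, Y1, 1), (Ym1, X1, 1)]),
                 (6, [(X1, X0), (X1, X0)], [(Z0, V0, 4), (X0, Z0, 2), (Xm1, X0, 1)]),
                 (2, [(X1, X0), (X1, X0), (X0, Z0)], [(Z0, V0, 16), (Y0, Z0, 8), (Ym1, Y0, 4), (Zm1, Ym1, 2), (Xm1, Zm1, 1)])]))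
              (Leaf 26 [
                (2, [], [(Z0, V0, 8), (X0, Z0, 4), (X1, X0, 2), (Xm1, X0, 2), (Ym1, X1, 1), (Z1, X1, 1), (Zm1, Xm1, 1)]),
                (2, [], [(Vm1, V0, 16), (Zm1, Vm1, 8), (Xm1, Zm1, 4), (Ym1, Zm1, 4), (X0, Xm1, 2), (X1, Ym1, 2), (Z1, X1, 1)]),
                (1, [], [(Z0, V0, 8), (X0, Z0, 4), (Y0, Z0, 4), (X1, X0, 2), (Xm1, X0, 2), (Ym1, Y0, 2), (Z1, X1, 1)]),
                (2, [], [(V1, V0, 16), (Z1, V1, 8), (X1, Z1, 4), (X0, X1, 2), (Ym1, X1, 2), (Xm1, X0, 1), (Y0, Ym1, 1), (Zm1, Ym1, 1)]),
                (5, [], [(Z0, V0, 8), (X0, Z0, 4), (Y0, Z0, 4), (X1, X0, 2), (Xm1, X0, 2), (Ym1, Y0, 2), (Z1, X1, 1), (Zm1, Xm1, 1)])]))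
             (Split Y1 5
              (Split Ym1 0
               (Split X0 0
                (Split X1 1
                 (Leaf 4 [
                   (1, [], [(Z0, V0, 4), (X0, Z0, 2), (Y0, Z0, 2), (X1, X0, 1), (Xm1, X0, 1), (Y1, Y0, 1)]),
                   (1, [], [(V1, V0, 8), (Z1, V1, 4), (Y1, Z1, 2), (Xm1, Y1, 1)]),
                   (1, [], [(Vm1, V0, 8), (Zm1, Vm1, 4), (Xm1, Zm1, 2), (Y1, Xm1, 1)])])
                 (Leaf 50 [
                   (6, [], [(V1, V0, 16), (Z1, V1, 8), (X1, Z1, 4), (Y1, Z1, 4), (Xm1, Y1, 2), (Zm1, Xm1, 1)]),
                   (4, [], [(Vm1, V0, 8), (Zm1, Vm1, 4), (Xm1, Zm1, 2), (Ym1, Zm1, 2), (X1, Ym1, 1), (Y1, Xm1, 1)]),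
                   (2, [], [(Z0, V0, 8), (X0, Z0, 4), (Y0, Z0, 4), (X1, X0, 2), (Xm1, X0, 2), (Zm1, Xm1, 1)]),
                   (9, [], [(Z0, V0, 8), (X0, Z0, 4), (Y0, Z0, 4), (X1, X0, 2), (Xm1, X0, 2), (Y1, Y0, 2), (Zm1, Xm1, 1)]),
                   (2, [(X1, Z1)], [(Vm1, V0, 16), (Zm1, Vm1, 8), (Xm1, Zm1, 4), (Y1, Xm1, 2), (Z1, Y1, 1)])]))
                (Leaf 28 [
                  (3, [], [(V1, V0, 16), (Z1, V1, 8), (X1, Z1, 4), (Y1, Z1, 4), (Xm1, Y1, 2), (Zm1, Xm1, 1)]),
                  (2, [], [(Z0, V0, 8), (X0, Z0, 4), (X1, X0, 2), (Xm1, X0, 2), (Y1, Xm1, 1), (Z1, X1, 1), (Zm1, Xm1, 1)]),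
                  (2, [], [(Vm1, V0, 16), (Zm1, Vm1, 8), (Xm1, Zm1, 4), (X0, Xm1, 2), (Y1, Xm1, 2), (X1, X0, 1), (Y0, Y1, 1), (Z1, Y1, 1)]),
                  (5, [], [(Z0, V0, 8), (X0, Z0, 4), (Y0, Z0, 4), (X1, X0, 2), (Xm1, X0, 2), (Y1, Y0, 2), (Zm1, Xm1, 1)])]))
               (Split Ym1 5
                (Split Zm1 1
                 (Split Z1 1
                  (Split V1 0
                   (Split Xm1 3
                    (Split Ym1 3
                     (Split Vm1 0
                      (Split X1 3
                       (Split Y1 3
                        (Split Z1 0
                         (Split X1 1
                          (Leaf 4 [
                            (1, [], [(Vm1, V0, 8), (Zm1, Vm1, 4), (Xm1, Zm1, 2), (Ym1, Zm1, 2), (Y1, Xm1, 1)]),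
                            (2, [], [(Z0, V0, 4), (X0, Z0, 2), (Y0, Z0, 2), (X1, X0, 1), (Xm1, X0, 1), (Y1, Y0, 1), (Ym1, Y0, 1)])])
                          (Split X0 0
                           (Split Xm1 1
                            (Leaf 3 [
                              (1, [], [(Z0, V0, 8), (Y0, Z0, 4), (Y1, Y0, 2), (Ym1, Y0, 2), (X1, Ym1, 1)])])
                            (Leaf 1 [
                              (1, [(X1, X0), (Xm1, X0), (X0, Z0)], [(Z0, V0, 4), (Y0, Z0, 2), (Y1, Y0, 1), (Ym1, Y0, 1)])]))
                           (Leaf 2 [
                             (1, [], [(Z0, V0, 8), (X0, Z0, 4), (X1, X0, 2), (Xm1, X0, 2), (Y1, Xm1, 1), (Ym1, X1, 1)]),
                             (1, [(X1, X0), (X0, Z0)], [(Z0, V0, 4), (Y0, Z0, 2), (Y1, Y0, 1), (Ym1, Y0, 1)])])))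
                         (Split Zm1 0
                          (Split Xm1 1
                           (Leaf 3 [
                             (1, [], [(V1, V0, 8), (Z1, V1, 4), (X1, Z1, 2), (Y1, Z1, 2), (Ym1, X1, 1)]),
                             (1, [], [(Z0, V0, 4), (X0, Z0, 2), (Y0, Z0, 2), (X1, X0, 1), (Xm1, X0, 1), (Y1, Y0, 1), (Ym1, Y0, 1)])])
                           (Split X0 0
                            (Leaf 8 [
                              (2, [], [(V1, V0, 8), (Z1, V1, 4), (X1, Z1, 2), (Y1, Z1, 2), (Xm1, Y1, 1), (Ym1, X1, 1)]),
                              (2, [], [(Z0, V0, 8), (Y0, Z0, 4), (Y1, Y0, 2), (Ym1, Y0, 2), (X1, Ym1, 1), (Xm1, Y1, 1)]),
                              (1, [(Xm1, Y1), (Y1, Z1)], [(V1, V0, 8), (Z1, V1, 4), (X1, Z1, 2), (Ym1, X1, 1)])])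
                            (Leaf 2 [
                              (1, [], [(Z0, V0, 8), (X0, Z0, 4), (X1, X0, 2), (Xm1, X0, 2), (Y1, Xm1, 1), (Ym1, X1, 1), (Z1, X1, 1)]),
                              (1, [(Xm1, X0), (X0, Z0)], [(Z0, V0, 4), (Y0, Z0, 2), (Y1, Y0, 1), (Ym1, Y0, 1)])])))
                          (Split X0 0
                           (Split Y0 0
                            (Leaf 3 [
                              (1, [], [(V1, V0, 8), (Z1, V1, 4), (X1, Z1, 2), (Y1, Z1, 2), (Xm1, Y1, 1), (Ym1, X1, 1)]),
                              (1, [], [(Vm1, V0, 8), (Zm1, Vm1, 4), (Xm1, Zm1, 2), (Ym1, Zm1, 2), (X1, Ym1, 1), (Y1, Xm1, 1)])])
                            (Split Y1 1
                             (Split Xm1 1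
                              (Leaf 1 [])
                              (Leaf 5 [
                                (1, [], [(Vm1, V0, 8), (Zm1, Vm1, 4), (Xm1, Zm1, 2), (Ym1, Zm1, 2), (X1, Ym1, 1)]),
                                (1, [(Xm1, Y1), (Y1, Z1)], [(V1, V0, 16), (Z1, V1, 8), (X1, Z1, 4), (Ym1, X1, 2), (Zm1, Ym1, 1)])]))
                             (Leaf 3 [
                               (1, [], [(Z0, V0, 8), (Y0, Z0, 4), (Y1, Y0, 2), (Ym1, Y0, 2), (X1, Ym1, 1), (Xm1, Y1, 1)]),
                               (1, [(Y1, Y0), (Y0, Z0)], [(Z0, V0, 8), (X0, Z0, 4), (X1, X0, 2), (Xm1, X0, 2), (Ym1, X1, 1)])])))
                           (Split X1 1
                            (Split Xm1 1
                             (Split Y1 1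
                              (Leaf 1 [])
                              (Leaf 1 [
                                (1, [(Y1, Xm1), (Xm1, X0), (X0, Z0)], [(Z0, V0, 4), (Y0, Z0, 2), (Y1, Y0, 1), (Ym1, Y0, 1)])]))
                             (Leaf 1 [
                               (1, [(Xm1, X0), (X0, Z0)], [(Z0, V0, 4), (Y0, Z0, 2), (Y1, Y0, 1), (Ym1, Y0, 1)])]))
                            (Leaf 3 [
                              (1, [], [(Z0, V0, 8), (X0, Z0, 4), (X1, X0, 2), (Xm1, X0, 2), (Y1, Xm1, 1), (Ym1, X1, 1), (Z1, X1, 1)]),
                              (1, [(X1, X0), (X0, Z0)], [(Z0, V0, 8), (Y0, Z0, 4), (Y1, Y0, 2), (Ym1, Y0, 2), (Xm1, Y1, 1)])])))))
                        (Split Y0 0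
                         (Leaf 52 [
                           (7, [], [(Vm1, V0, 8), (Zm1, Vm1, 4), (Xm1, Zm1, 2), (Ym1, Zm1, 2), (Y1, Xm1, 1)]),
                           (12, [], [(V1, V0, 8), (Z1, V1, 4), (X1, Z1, 2), (Y1, Z1, 2), (Xm1, Y1, 1), (Ym1, X1, 1)]),
                           (3, [(Y1, Z1), (Y1, Xm1), (Xm1, Zm1)], [(Vm1, V0, 16), (Zm1, Vm1, 8), (Ym1, Zm1, 4), (X1, Ym1, 2), (Z1, X1, 1)]),
                           (13, [(Y1, Y0), (Y1, Y0), (Y0, Z0)], [(Z0, V0, 8), (X0, Z0, 4), (X1, X0, 2), (Xm1, X0, 2), (Ym1, X1, 1)])])
                         (Leaf 6 [
                           (3, [], [(Z0, V0, 8), (Y0, Z0, 4), (Y1, Y0, 2), (Ym1, Y0, 2), (X1, Ym1, 1), (Xm1, Y1, 1)]),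
                           (1, [(Y1, Z1), (Y1, Z1)], [(V1, V0, 16), (Z1, V1, 8), (X1, Z1, 4), (Ym1, X1, 2), (Zm1, Ym1, 1)]),
                           (3, [(Y1, Y0), (Y0, Z0), (Y1, Xm1)], [(Z0, V0, 4), (X0, Z0, 2), (Xm1, X0, 1)])])))
                       (Split X0 0
                        (Leaf 52 [
                          (7, [], [(Vm1, V0, 8), (Zm1, Vm1, 4), (Xm1, Zm1, 2), (Ym1, Zm1, 2), (X1, Ym1, 1)]),
                          (12, [], [(V1, V0, 8), (Z1, V1, 4), (X1, Z1, 2), (Y1, Z1, 2), (Xm1, Y1, 1), (Ym1, X1, 1)]),
                          (13, [(X1, X0), (X1, X0), (X0, Z0)], [(Z0, V0, 8), (Y0, Z0, 4), (Y1, Y0, 2), (Ym1, Y0, 2), (Xm1, Y1, 1)]),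
                          (3, [(X1, Z1), (X1, Ym1), (Ym1, Zm1)], [(Vm1, V0, 16), (Zm1, Vm1, 8), (Xm1, Zm1, 4), (Y1, Xm1, 2), (Z1, Y1, 1)])])
                        (Leaf 6 [
                          (1, [(X1, Z1), (X1, Z1)], [(V1, V0, 16), (Z1, V1, 8), (Y1, Z1, 4), (Xm1, Y1, 2), (Zm1, Xm1, 1)]),
                          (3, [], [(Z0, V0, 8), (X0, Z0, 4), (X1, X0, 2), (Xm1, X0, 2), (Y1, Xm1, 1), (Ym1, X1, 1)]),
                          (3, [(X1, X0), (X0, Z0), (X1, Ym1)], [(Z0, V0, 4), (Y0, Z0, 2), (Ym1, Y0, 1)])])))
                      (Split X0 0
                       (Leaf 1 [
                         (1, [], [(Vm1, V0, 8), (Zm1, Vm1, 4), (Xm1, Zm1, 2), (Ym1, Zm1, 2), (X1, Ym1, 1), (Y1, Xm1, 1)])])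
                       (Split X1 1
                        (Split Y1 1
                         (Leaf 1 [
                           (1, [], [(Vm1, V0, 4), (Zm1, Vm1, 2), (Xm1, Zm1, 1), (Ym1, Zm1, 1)])])
                         (Leaf 2 [
                           (1, [], [(Vm1, V0, 8), (Zm1, Vm1, 4), (Xm1, Zm1, 2), (Ym1, Zm1, 2), (Y1, Xm1, 1)]),
                           (1, [(Y1, Xm1), (Xm1, Zm1)], [(Vm1, V0, 16), (Zm1, Vm1, 8), (Ym1, Zm1, 4), (Y0, Ym1, 2), (Y1, Y0, 1)])]))
                        (Leaf 1 [
                          (1, [(X1, Ym1), (Ym1, Zm1)], [(Vm1, V0, 16), (Zm1, Vm1, 8), (Xm1, Zm1, 4), (X0, Xm1, 2), (X1, X0, 1)]),
                          (1, [(X1, X0), (X0, Z0)], [(Z0, V0, 4), (Y0, Z0, 2), (Y1, Y0, 1), (Ym1, Y0, 1)])]))))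
                     (Split Y0 0
                      (Leaf 55 [
                        (7, [], [(V1, V0, 8), (Z1, V1, 4), (X1, Z1, 2), (Y1, Z1, 2), (Ym1, X1, 1)]),
                        (13, [], [(Vm1, V0, 8), (Zm1, Vm1, 4), (Xm1, Zm1, 2), (Ym1, Zm1, 2), (X1, Ym1, 1), (Y1, Xm1, 1)]),
                        (1, [], [(Z0, V0, 8), (Y0, Z0, 4), (Y1, Y0, 2), (Ym1, Y0, 2), (X1, Ym1, 1)]),
                        (3, [(Ym1, Zm1), (Ym1, X1), (X1, Z1)], [(V1, V0, 16), (Z1, V1, 8), (Y1, Z1, 4), (Xm1, Y1, 2), (Zm1, Xm1, 1)]),
                        (14, [(Ym1, Y0), (Ym1, Y0), (Y0, Z0)], [(Z0, V0, 8), (X0, Z0, 4), (X1, X0, 2), (Xm1, X0, 2), (Y1, Xm1, 1)])])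
                      (Leaf 6 [
                        (3, [], [(Z0, V0, 8), (Y0, Z0, 4), (Y1, Y0, 2), (Ym1, Y0, 2), (X1, Ym1, 1), (Xm1, Y1, 1)]),
                        (1, [(Ym1, Zm1), (Ym1, Zm1)], [(Vm1, V0, 16), (Zm1, Vm1, 8), (Xm1, Zm1, 4), (Y1, Xm1, 2), (Z1, Y1, 1)]),
                        (3, [(Ym1, Y0), (Y0, Z0), (Ym1, X1)], [(Z0, V0, 4), (X0, Z0, 2), (X1, X0, 1)])])))
                    (Split X0 0
                     (Leaf 55 [
                       (7, [], [(V1, V0, 8), (Z1, V1, 4), (X1, Z1, 2), (Y1, Z1, 2), (Xm1, Y1, 1), (Ym1, X1, 1)]),
                       (13, [], [(Vm1, V0, 8), (Zm1, Vm1, 4), (Xm1, Zm1, 2), (Ym1, Zm1, 2), (X1, Ym1, 1), (Y1, Xm1, 1)]),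
                       (1, [], [(Z0, V0, 8), (X0, Z0, 4), (X1, X0, 2), (Xm1, X0, 2), (Y1, Xm1, 1), (Ym1, X1, 1)]),
                       (3, [(Xm1, Zm1), (Xm1, Y1), (Y1, Z1)], [(V1, V0, 16), (Z1, V1, 8), (X1, Z1, 4), (Ym1, X1, 2), (Zm1, Ym1, 1)]),
                       (14, [(Xm1, X0), (Xm1, X0), (X0, Z0)], [(Z0, V0, 8), (Y0, Z0, 4), (Y1, Y0, 2), (Ym1, Y0, 2), (X1, Ym1, 1)])])
                     (Leaf 6 [
                       (1, [(Xm1, Zm1), (Xm1, Zm1)], [(Vm1, V0, 16), (Zm1, Vm1, 8), (Ym1, Zm1, 4), (X1, Ym1, 2), (Z1, X1, 1)]),
                       (3, [], [(Z0, V0, 8), (X0, Z0, 4), (X1, X0, 2), (Xm1, X0, 2), (Y1, Xm1, 1), (Ym1, X1, 1)]),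
                       (3, [(Xm1, X0), (X0, Z0), (Xm1, Y1)], [(Z0, V0, 4), (Y0, Z0, 2), (Y1, Y0, 1)])])))
                   (Split X0 0
                    (Leaf 5 [
                      (1, [], [(Vm1, V0, 8), (Zm1, Vm1, 4), (Xm1, Zm1, 2), (Ym1, Zm1, 2), (X1, Ym1, 1)]),
                      (4, [], [(V1, V0, 8), (Z1, V1, 4), (X1, Z1, 2), (Y1, Z1, 2), (Xm1, Y1, 1), (Ym1, X1, 1)])])
                    (Split X1 1
                     (Split Xm1 1
                      (Split Ym1 1
                       (Leaf 1 [
                         (1, [], [(V1, V0, 4), (Z1, V1, 2), (Y1, Z1, 1)])])
                       (Leaf 3 [
                         (1, [], [(Vm1, V0, 4), (Zm1, Vm1, 2), (Ym1, Zm1, 1)]),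
                         (2, [(Ym1, X1), (X1, Z1)], [(V1, V0, 16), (Z1, V1, 8), (Y1, Z1, 4), (Y0, Y1, 2), (Ym1, Y0, 1)])]))
                      (Leaf 4 [
                        (1, [], [(Vm1, V0, 8), (Zm1, Vm1, 4), (Xm1, Zm1, 2), (Ym1, Zm1, 2), (Y1, Xm1, 1)]),
                        (1, [], [(V1, V0, 8), (Z1, V1, 4), (X1, Z1, 2), (Y1, Z1, 2), (Xm1, Y1, 1), (Ym1, X1, 1)]),
                        (2, [(Xm1, Y1), (Y1, Z1)], [(V1, V0, 16), (Z1, V1, 8), (X1, Z1, 4), (X0, X1, 2), (Xm1, X0, 1)]),
                        (2, [(Xm1, X0), (X0, Z0)], [(Z0, V0, 4), (Y0, Z0, 2), (Y1, Y0, 1), (Ym1, Y0, 1)])]))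
                     (Leaf 3 [
                       (2, [], [(V1, V0, 8), (Z1, V1, 4), (X1, Z1, 2), (Y1, Z1, 2), (Xm1, Y1, 1), (Ym1, X1, 1)]),
                       (1, [(X1, X0), (X0, Z0)], [(Z0, V0, 8), (Y0, Z0, 4), (Y1, Y0, 2), (Ym1, Y0, 2), (Xm1, Y1, 1)])]))))
                  (Leaf 37 [
                    (13, [], [(V1, V0, 8), (Z1, V1, 4), (X1, Z1, 2), (Y1, Z1, 2), (Xm1, Y1, 1), (Ym1, X1, 1)]),
                    (2, [(Z1, Y1), (Y1, Xm1), (Xm1, Zm1)], [(Vm1, V0, 8), (Zm1, Vm1, 4), (Ym1, Zm1, 2), (X1, Ym1, 1)]),
                    (1, [(Z1, Y1), (Y1, Xm1)], [(Vm1, V0, 8), (Zm1, Vm1, 4), (Xm1, Zm1, 2), (Ym1, Zm1, 2), (X1, Ym1, 1)]),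
                    (5, [(Z1, X1), (X1, X0)], [(Z0, V0, 8), (X0, Z0, 4), (Y0, Z0, 4), (Xm1, X0, 2), (Y1, Y0, 2), (Ym1, Y0, 2), (Zm1, Xm1, 1)]),
                    (4, [(Z1, Y1), (Y1, Y0)], [(Z0, V0, 8), (X0, Z0, 4), (Y0, Z0, 4), (X1, X0, 2), (Xm1, X0, 2), (Ym1, Y0, 2), (Zm1, Xm1, 1)]),
                    (2, [(Z1, X1), (X1, Ym1), (Ym1, Zm1)], [(Vm1, V0, 8), (Zm1, Vm1, 4), (Xm1, Zm1, 2), (Y1, Xm1, 1)])]))
                 (Leaf 64 [
                   (11, [], [(Vm1, V0, 16), (Zm1, Vm1, 8), (Xm1, Zm1, 4), (Ym1, Zm1, 4), (X1, Ym1, 2), (Y1, Xm1, 2), (Z1, X1, 1)]),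
                   (1, [(Zm1, Xm1), (Xm1, Y1)], [(V1, V0, 8), (Z1, V1, 4), (X1, Z1, 2), (Y1, Z1, 2), (Ym1, X1, 1)]),
                   (4, [(Zm1, Ym1), (Ym1, X1), (X1, Z1)], [(V1, V0, 8), (Z1, V1, 4), (Y1, Z1, 2), (Xm1, Y1, 1)]),
                   (8, [(Zm1, Ym1), (Ym1, Y0)], [(Z0, V0, 8), (X0, Z0, 4), (Y0, Z0, 4), (X1, X0, 2), (Xm1, X0, 2), (Y1, Y0, 2), (Z1, X1, 1)]),
                   (8, [(Zm1, Xm1), (Xm1, X0)], [(Z0, V0, 8), (X0, Z0, 4), (Y0, Z0, 4), (X1, X0, 2), (Y1, Y0, 2), (Ym1, Y0, 2), (Z1, X1, 1)]),
                   (4, [(Zm1, Xm1), (Xm1, Y1), (Y1, Z1)], [(V1, V0, 8), (Z1, V1, 4), (X1, Z1, 2), (Ym1, X1, 1)])]))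
                (Leaf 8 [
                  (3, [], [(Z0, V0, 8), (Y0, Z0, 4), (Y1, Y0, 2), (Ym1, Y0, 2), (X1, Ym1, 1), (Xm1, Y1, 1), (Z1, Y1, 1)]),
                  (8, [(Ym1, Zm1), (Ym1, Zm1), (Ym1, Zm1)], [(Vm1, V0, 2), (Zm1, Vm1, 1)]),
                  (2, [(Ym1, X1), (Ym1, X1), (Ym1, X1)], [(V1, V0, 4), (Z1, V1, 2), (X1, Z1, 1)]),
                  (2, [(Ym1, Y0), (Ym1, Y0), (Y0, Z0)], [(Z0, V0, 8), (X0, Z0, 4), (X1, X0, 2), (Ym1, X1, 1)]),
                  (5, [(Ym1, Y0), (Ym1, Y0), (Ym1, Y0)], [(Z0, V0, 8), (Y0, Z0, 4), (Y1, Y0, 2), (Xm1, Y1, 1)])])))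
              (Leaf 14 [
                (2, [], [(V1, V0, 16), (Z1, V1, 8), (X1, Z1, 4), (Y1, Z1, 4), (Xm1, Y1, 2), (Zm1, Xm1, 1)]),
                (2, [], [(Vm1, V0, 8), (Zm1, Vm1, 4), (Xm1, Zm1, 2), (Ym1, Zm1, 2), (X1, Ym1, 1), (Y1, Xm1, 1)]),
                (4, [(Y1, Y0), (Y1, Y0), (Y0, Z0)], [(Z0, V0, 8), (X0, Z0, 4), (Xm1, X0, 2), (Y1, Xm1, 1)]),
                (1, [(Y1, Z1), (Y1, Z1), (Y1, Z1)], [(V1, V0, 16), (Z1, V1, 8), (X1, Z1, 4), (Ym1, X1, 2), (Zm1, Ym1, 1)]),
                (4, [(Y1, Y0), (Y1, Y0), (Y1, Y0)], [(Z0, V0, 8), (Y0, Z0, 4), (Ym1, Y0, 2), (X1, Ym1, 1), (Zm1, Ym1, 1)])])))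
            (Leaf 24 [
              (3, [], [(Vm1, V0, 8), (Zm1, Vm1, 4), (Xm1, Zm1, 2), (Ym1, Zm1, 2), (X1, Ym1, 1)]),
              (3, [], [(V1, V0, 16), (Z1, V1, 8), (X1, Z1, 4), (Ym1, X1, 2), (Zm1, Ym1, 1)]),
              (2, [], [(Z0, V0, 8), (X0, Z0, 4), (X1, X0, 2), (Xm1, X0, 2), (Zm1, Xm1, 1)]),
              (9, [(X1, X0), (X1, X0), (X1, X0)], [(Z0, V0, 2), (X0, Z0, 1)]),
              (6, [(X1, X0), (X1, X0), (X0, Z0)], [(Z0, V0, 8), (Y0, Z0, 4), (Ym1, Y0, 2), (X1, Ym1, 1)]),
              (1, [(X1, X0), (X1, X0), (X1, X0)], [(Z0, V0, 16), (X0, Z0, 8), (Xm1, X0, 4), (Y1, Xm1, 2), (Zm1, Xm1, 2), (Ym1, Zm1, 1)]),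
              (6, [(X1, Z1), (X1, Z1), (X1, Z1)], [(V1, V0, 16), (Z1, V1, 8), (Y1, Z1, 4), (Xm1, Y1, 2), (Zm1, Xm1, 1)])])))
          (Leaf 8 [
            (2, [], [(Vm1, V0, 4), (Zm1, Vm1, 2), (Xm1, Zm1, 1)]),
            (1, [], [(Vm1, V0, 8), (Zm1, Vm1, 4), (Xm1, Zm1, 2), (Ym1, Zm1, 2), (Y1, Xm1, 1)]),
            (2, [], [(Z0, V0, 4), (X0, Z0, 2), (X1, X0, 1), (Xm1, X0, 1)]),
            (2, [(Xm1, Y1), (Xm1, Y1), (Xm1, Y1)], [(V1, V0, 4), (Z1, V1, 2), (Y1, Z1, 1)]),
            (1, [(Xm1, X0), (Xm1, X0), (Xm1, X0)], [(Z0, V0, 16), (X0, Z0, 8), (X1, X0, 4), (Ym1, X1, 2), (Z1, X1, 2), (Y1, Z1, 1)]),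
            (2, [(Xm1, X0), (Xm1, X0), (X0, Z0)], [(Z0, V0, 8), (Y0, Z0, 4), (Y1, Y0, 2), (Ym1, Y0, 2), (X1, Ym1, 1), (Xm1, Y1, 1), (Z1, Y1, 1)])])))
        (Leaf 0 [
          (1, [], [(Vm1, V0, 1)])]))
       (Leaf 12 [
         (1, [], [(Vm1, V0, 16), (Zm1, Vm1, 8), (Xm1, Zm1, 4), (Ym1, Zm1, 4), (X0, Xm1, 2), (X1, Ym1, 2), (Z1, X1, 1)]),
         (3, [], [(V1, V0, 16), (Z1, V1, 8), (Y1, Z1, 4), (Xm1, Y1, 2), (Y0, Y1, 2), (X0, Xm1, 1), (Ym1, Y0, 1), (Zm1, Xm1, 1)]),
         (3, [], [(V1, V0, 16), (Z1, V1, 8), (X1, Z1, 4), (X0, X1, 2), (Ym1, X1, 2), (Xm1, X0, 1), (Y0, Ym1, 1), (Zm1, Ym1, 1)])]))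
      (Leaf 15 [
        (2, [], [(Z0, V0, 8), (X0, Z0, 4), (X1, X0, 2), (Xm1, X0, 2), (Ym1, X1, 1), (Z1, X1, 1), (Zm1, Xm1, 1)]),
        (2, [], [(Z0, V0, 8), (Y0, Z0, 4), (Y1, Y0, 2), (Ym1, Y0, 2), (Z1, Y1, 1), (Zm1, Ym1, 1)]),
        (1, [], [(Vm1, V0, 16), (Zm1, Vm1, 8), (Xm1, Zm1, 4), (Ym1, Zm1, 4), (X1, Ym1, 2), (Y1, Xm1, 2), (Z1, X1, 1)]),
        (1, [], [(V1, V0, 16), (Z1, V1, 8), (X1, Z1, 4), (Y1, Z1, 4), (Xm1, Y1, 2), (Ym1, X1, 2), (Zm1, Xm1, 1)]),
        (1, [], [(Z0, V0, 8), (Y0, Z0, 4), (Y1, Y0, 2), (Ym1, Y0, 2), (X1, Ym1, 1), (Xm1, Y1, 1), (Z1, Y1, 1)]),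
        (2, [], [(Z0, V0, 8), (X0, Z0, 4), (X1, X0, 2), (Xm1, X0, 2), (Y1, Xm1, 1), (Z1, X1, 1), (Zm1, Xm1, 1)]),
        (1, [], [(Z0, V0, 8), (Y0, Z0, 4), (Y1, Y0, 2), (Ym1, Y0, 2), (X1, Ym1, 1), (Xm1, Y1, 1), (Zm1, Ym1, 1)])]))
     (Leaf 32 [
       (2, [], [(Z0, V0, 8), (Y0, Z0, 4), (Y1, Y0, 2), (Ym1, Y0, 2), (Z1, Y1, 1), (Zm1, Ym1, 1)]),
       (1, [], [(Z0, V0, 8), (Y0, Z0, 4), (Y1, Y0, 2), (Ym1, Y0, 2), (X1, Ym1, 1), (Xm1, Y1, 1), (Z1, Y1, 1)]),
       (4, [], [(Z0, V0, 8), (Y0, Z0, 4), (Y1, Y0, 2), (Ym1, Y0, 2), (Xm1, Y1, 1), (Z1, Y1, 1), (Zm1, Ym1, 1)]),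
       (7, [(Y0, Z0)], [(Z0, V0, 8), (X0, Z0, 4), (X1, X0, 2), (Xm1, X0, 2), (Z1, X1, 1), (Zm1, Xm1, 1)]),
       (1, [(Y0, Z0)], [(Z0, V0, 8), (X0, Z0, 4), (X1, X0, 2), (Xm1, X0, 2), (Y1, Xm1, 1), (Ym1, X1, 1)]),
       (4, [(Y0, Y1)], [(V1, V0, 8), (Z1, V1, 4), (X1, Z1, 2), (Y1, Z1, 2), (Ym1, X1, 1)]),
       (2, [], [(Vm1, V0, 16), (Zm1, Vm1, 8), (Xm1, Zm1, 4), (Ym1, Zm1, 4), (X1, Ym1, 2), (Y0, Ym1, 2), (Y1, Xm1, 2), (Z1, X1, 1)]),
       (3, [], [(Z0, V0, 8), (Y0, Z0, 4), (Y1, Y0, 2), (Ym1, Y0, 2), (X1, Ym1, 1), (Xm1, Y1, 1), (Zm1, Ym1, 1)])]))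
    (Leaf 16 [
      (2, [], [(Z0, V0, 8), (X0, Z0, 4), (X1, X0, 2), (Xm1, X0, 2), (Ym1, X1, 1), (Z1, X1, 1), (Zm1, Xm1, 1)]),
      (2, [(X0, Z0)], [(Z0, V0, 8), (Y0, Z0, 4), (Y1, Y0, 2), (Ym1, Y0, 2), (X1, Ym1, 1), (Z1, Y1, 1), (Zm1, Ym1, 1)]),
      (1, [(X0, Xm1)], [(Vm1, V0, 16), (Zm1, Vm1, 8), (Xm1, Zm1, 4), (Ym1, Zm1, 4), (X1, Ym1, 2), (Y1, Xm1, 2), (Z1, X1, 1)]),
      (1, [], [(Z0, V0, 8), (X0, Z0, 4), (X1, X0, 2), (Xm1, X0, 2), (Y1, Xm1, 1), (Z1, X1, 1), (Zm1, Xm1, 1)]),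
      (2, [(X0, Z0)], [(Z0, V0, 8), (Y0, Z0, 4), (Y1, Y0, 2), (Ym1, Y0, 2), (Xm1, Y1, 1), (Z1, Y1, 1)]),
      (2, [(X0, X1)], [(V1, V0, 8), (Z1, V1, 4), (X1, Z1, 2), (Y1, Z1, 2), (Xm1, Y1, 1), (Ym1, X1, 1)]),
      (1, [], [(Z0, V0, 8), (X0, Z0, 4), (X1, X0, 2), (Xm1, X0, 2), (Y1, Xm1, 1), (Zm1, Xm1, 1)])]))
   (Leaf 32 [
     (1, [], [(Z0, V0, 8), (Y0, Z0, 4), (Y1, Y0, 2), (Ym1, Y0, 2), (Z1, Y1, 1), (Zm1, Ym1, 1)]),
     (1, [], [(V1, V0, 16), (Z1, V1, 8), (X1, Z1, 4), (Y1, Z1, 4), (X0, X1, 2), (Ym1, X1, 2), (Zm1, Ym1, 1)]),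
     (1, [], [(Z0, V0, 8), (X0, Z0, 4), (X1, X0, 2), (Xm1, X0, 2), (Y1, Xm1, 1), (Z1, X1, 1), (Zm1, Xm1, 1)]),
     (1, [], [(Z0, V0, 8), (X0, Z0, 4), (Y0, Z0, 4), (X1, X0, 2), (Y1, Y0, 2), (Ym1, Y0, 2), (Zm1, Ym1, 1)]),
     (3, [], [(Vm1, V0, 16), (Zm1, Vm1, 8), (Ym1, Zm1, 4), (X1, Ym1, 2), (Y0, Ym1, 2), (Y1, Y0, 1), (Z1, X1, 1)]),
     (7, [], [(Vm1, V0, 16), (Zm1, Vm1, 8), (Xm1, Zm1, 4), (X0, Xm1, 2), (Y1, Xm1, 2), (X1, X0, 1), (Y0, Y1, 1), (Z1, Y1, 1)]),
     (3, [], [(Vm1, V0, 16), (Zm1, Vm1, 8), (Ym1, Zm1, 4), (X1, Ym1, 2), (Y0, Ym1, 2), (X0, X1, 1), (Z1, X1, 1)]),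
     (1, [], [(V1, V0, 16), (Z1, V1, 8), (X1, Z1, 4), (Y1, Z1, 4), (X0, X1, 2), (Y0, Y1, 2), (Ym1, X1, 2), (Zm1, Ym1, 1)]),
     (1, [(Zm1, Xm1)], [(Z0, V0, 8), (X0, Z0, 4), (Y0, Z0, 4), (X1, X0, 2), (Xm1, X0, 2), (Y1, Y0, 2), (Z1, X1, 1)])])"

text \<open>Seven splits suffice for this root. In the three leaves that use moves, a pebble
  guaranteed on \<open>X1\<close> or \<open>Xm1\<close> is joined by a second one from
  \<open>Z1\<close> or \<open>Zm1\<close>, and the pair sends a pebble to \<open>X0\<close>, next to
  the root.\<close>

definition cert_Z0 :: "J3_vertex cert" where
  "cert_Z0 =
   Split V1 1
   (Split X1 0
    (Leaf 20 [
      (3, [], [(X0, Z0, 8), (X1, X0, 4), (Xm1, X0, 4), (Y1, Xm1, 2), (Ym1, X1, 2), (Z1, X1, 2), (Zm1, Xm1, 2), (V1, Z1, 1), (Vm1, Zm1, 1)]),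
      (2, [], [(V0, Z0, 8), (V1, V0, 4), (Vm1, V0, 4), (Z1, V1, 2), (Zm1, Vm1, 2), (Ym1, Zm1, 1)]),
      (3, [], [(Y0, Z0, 8), (Y1, Y0, 4), (Ym1, Y0, 4), (Xm1, Y1, 2), (Z1, Y1, 2), (Zm1, Ym1, 2), (Vm1, Zm1, 1)]),
      (2, [], [(V0, Z0, 8), (V1, V0, 4), (Vm1, V0, 4), (Z1, V1, 2), (Zm1, Vm1, 2), (X1, Z1, 1), (Xm1, Zm1, 1), (Y1, Z1, 1)])])
    (Split Z1 3
     (Split Y1 1
      (Split Z1 2
       (Split Xm1 0
        (Leaf 12 [
          (2, [], [(X0, Z0, 8), (X1, X0, 4), (Xm1, X0, 4), (Y1, Xm1, 2), (Ym1, X1, 2), (Z1, X1, 2), (Zm1, Xm1, 2), (V1, Z1, 1), (Vm1, Zm1, 1)]),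
          (1, [], [(V0, Z0, 8), (V1, V0, 4), (Vm1, V0, 4), (Z1, V1, 2), (Zm1, Vm1, 2), (Ym1, Zm1, 1)]),
          (2, [], [(Y0, Z0, 8), (Y1, Y0, 4), (Ym1, Y0, 4), (X1, Ym1, 2), (Z1, Y1, 2), (Zm1, Ym1, 2), (Vm1, Zm1, 1)]),
          (1, [], [(V0, Z0, 8), (V1, V0, 4), (Vm1, V0, 4), (Z1, V1, 2), (Zm1, Vm1, 2), (X1, Z1, 1), (Xm1, Zm1, 1), (Y1, Z1, 1)])])
        (Split Zm1 1
         (Leaf 33 [
           (5, [], [(X0, Z0, 8), (X1, X0, 4), (Xm1, X0, 4), (Y1, Xm1, 2), (Ym1, X1, 2), (Z1, X1, 2), (Zm1, Xm1, 2), (V1, Z1, 1), (Vm1, Zm1, 1)]),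
           (3, [], [(V0, Z0, 8), (V1, V0, 4), (Vm1, V0, 4), (Z1, V1, 2), (Zm1, Vm1, 2), (Ym1, Zm1, 1)]),
           (3, [], [(V0, Z0, 8), (V1, V0, 4), (Vm1, V0, 4), (Z1, V1, 2), (Zm1, Vm1, 2), (X1, Z1, 1), (Xm1, Zm1, 1), (Y1, Z1, 1)]),
           (5, [], [(Y0, Z0, 8), (Y1, Y0, 4), (Ym1, Y0, 4), (X1, Ym1, 2), (Xm1, Y1, 2), (Z1, Y1, 2), (Zm1, Ym1, 2), (V1, Z1, 1), (Vm1, Zm1, 1)])])
         (Leaf 22 [
           (3, [], [(X0, Z0, 8), (X1, X0, 4), (Xm1, X0, 4), (Y1, Xm1, 2), (Ym1, X1, 2), (Z1, X1, 2), (Zm1, Xm1, 2), (V1, Z1, 1), (Vm1, Zm1, 1)]),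
           (4, [], [(V0, Z0, 8), (V1, V0, 4), (Vm1, V0, 4), (Z1, V1, 2), (Zm1, Vm1, 2), (X1, Z1, 1), (Xm1, Zm1, 1), (Y1, Z1, 1)]),
           (3, [], [(Y0, Z0, 8), (Y1, Y0, 4), (Ym1, Y0, 4), (X1, Ym1, 2), (Xm1, Y1, 2), (Z1, Y1, 2), (Zm1, Ym1, 2), (V1, Z1, 1), (Vm1, Zm1, 1)]),
           (2, [(Zm1, Xm1), (Xm1, X0)], [(X0, Z0, 8), (X1, X0, 4), (Ym1, X1, 2), (Zm1, Ym1, 1)])])))
       (Leaf 33 [
         (5, [], [(X0, Z0, 8), (X1, X0, 4), (Xm1, X0, 4), (Y1, Xm1, 2), (Ym1, X1, 2), (Z1, X1, 2), (Zm1, Xm1, 2), (V1, Z1, 1), (Vm1, Zm1, 1)]),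
         (3, [], [(V0, Z0, 8), (V1, V0, 4), (Vm1, V0, 4), (Z1, V1, 2), (Zm1, Vm1, 2), (Ym1, Zm1, 1)]),
         (1, [], [(Y0, Z0, 8), (Y1, Y0, 4), (Ym1, Y0, 4), (X1, Ym1, 2), (Z1, Y1, 2), (Zm1, Ym1, 2), (Vm1, Zm1, 1)]),
         (3, [], [(V0, Z0, 8), (V1, V0, 4), (Vm1, V0, 4), (Z1, V1, 2), (Zm1, Vm1, 2), (X1, Z1, 1), (Xm1, Zm1, 1), (Y1, Z1, 1)]),
         (4, [], [(Y0, Z0, 8), (Y1, Y0, 4), (Ym1, Y0, 4), (X1, Ym1, 2), (Xm1, Y1, 2), (Z1, Y1, 2), (Zm1, Ym1, 2), (V1, Z1, 1), (Vm1, Zm1, 1)]),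
         (1, [(Z1, X1), (X1, X0)], [(X0, Z0, 4), (Xm1, X0, 2), (Zm1, Xm1, 1)])]))
      (Leaf 22 [
        (3, [], [(X0, Z0, 8), (X1, X0, 4), (Xm1, X0, 4), (Y1, Xm1, 2), (Ym1, X1, 2), (Z1, X1, 2), (Zm1, Xm1, 2), (V1, Z1, 1), (Vm1, Zm1, 1)]),
        (1, [], [(Y0, Z0, 8), (Y1, Y0, 4), (Ym1, Y0, 4), (Xm1, Y1, 2), (Z1, Y1, 2), (Zm1, Ym1, 2), (Vm1, Zm1, 1)]),
        (1, [], [(Y0, Z0, 8), (Y1, Y0, 4), (Ym1, Y0, 4), (X1, Ym1, 2), (Z1, Y1, 2), (Zm1, Ym1, 2), (Vm1, Zm1, 1)]),
        (1, [], [(Y0, Z0, 8), (Y1, Y0, 4), (Ym1, Y0, 4), (X1, Ym1, 2), (Xm1, Y1, 2), (Z1, Y1, 2), (Zm1, Ym1, 2), (V1, Z1, 1)]),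
        (4, [], [(V0, Z0, 8), (V1, V0, 4), (Vm1, V0, 4), (Z1, V1, 2), (Zm1, Vm1, 2), (X1, Z1, 1), (Xm1, Zm1, 1), (Y1, Z1, 1)]),
        (1, [], [(Y0, Z0, 8), (Y1, Y0, 4), (Ym1, Y0, 4), (X1, Ym1, 2), (Xm1, Y1, 2), (Z1, Y1, 2), (Zm1, Ym1, 2), (V1, Z1, 1), (Vm1, Zm1, 1)])]))
     (Leaf 23 [
       (4, [], [(X0, Z0, 8), (X1, X0, 4), (Xm1, X0, 4), (Y1, Xm1, 2), (Ym1, X1, 2), (Z1, X1, 2), (Zm1, Xm1, 2), (V1, Z1, 1), (Vm1, Zm1, 1)]),
       (3, [], [(V0, Z0, 8), (V1, V0, 4), (Vm1, V0, 4), (Z1, V1, 2), (Zm1, Vm1, 2), (Ym1, Zm1, 1)]),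
       (3, [], [(Y0, Z0, 8), (Y1, Y0, 4), (Ym1, Y0, 4), (X1, Ym1, 2), (Z1, Y1, 2), (Zm1, Ym1, 2), (Vm1, Zm1, 1)]),
       (1, [], [(V0, Z0, 8), (V1, V0, 4), (Vm1, V0, 4), (Z1, V1, 2), (Zm1, Vm1, 2), (X1, Z1, 1), (Xm1, Zm1, 1), (Y1, Z1, 1)]),
       (1, [(Z1, X1), (X1, X0)], [(X0, Z0, 8), (Xm1, X0, 4), (Y1, Xm1, 2), (Z1, Y1, 1)]),
       (1, [(Z1, X1), (X1, X0)], [(X0, Z0, 4), (Xm1, X0, 2), (Zm1, Xm1, 1)])])))
   (Leaf 20 [
     (3, [], [(X0, Z0, 8), (X1, X0, 4), (Xm1, X0, 4), (Y1, Xm1, 2), (Ym1, X1, 2), (Z1, X1, 2), (Zm1, Xm1, 2), (V1, Z1, 1), (Vm1, Zm1, 1)]),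
     (2, [], [(V0, Z0, 8), (V1, V0, 4), (Vm1, V0, 4), (Z1, V1, 2), (Zm1, Vm1, 2), (Ym1, Zm1, 1)]),
     (2, [], [(Y0, Z0, 8), (Y1, Y0, 4), (Ym1, Y0, 4), (X1, Ym1, 2), (Xm1, Y1, 2), (Z1, Y1, 2), (Zm1, Ym1, 2), (V1, Z1, 1)]),
     (2, [], [(V0, Z0, 8), (V1, V0, 4), (Vm1, V0, 4), (Z1, V1, 2), (Zm1, Vm1, 2), (X1, Z1, 1), (Xm1, Zm1, 1), (Y1, Z1, 1)]),
     (1, [], [(Y0, Z0, 8), (Y1, Y0, 4), (Ym1, Y0, 4), (X1, Ym1, 2), (Xm1, Y1, 2), (Z1, Y1, 2), (Zm1, Ym1, 2), (V1, Z1, 1), (Vm1, Zm1, 1)])])"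

text \<open>Twenty splits are used. The leaf \<open>Leaf 1 []\<close> combines no bounds: the upper
  corner of its box holds only 11 pebbles, so counting alone excludes it.\<close>

definition cert_X0 :: "J3_vertex cert" where
  "cert_X0 =
   Split Y1 1
   (Split Y0 1
    (Split Ym1 2
     (Split Z1 2
      (Split V0 2
       (Split Z0 0
        (Split Y1 0
         (Leaf 10 [
           (1, [], [(Xm1, X0, 8), (Zm1, Xm1, 4), (Vm1, Zm1, 2), (V1, Vm1, 1)]),
           (1, [], [(X1, X0, 8), (Ym1, X1, 4), (Z1, X1, 4), (V1, Z1, 2), (Vm1, V1, 1)]),
           (2, [], [(Z0, X0, 8), (V0, Z0, 4), (V1, V0, 2), (Vm1, V0, 2), (Z1, V1, 1), (Zm1, Vm1, 1)]),
           (1, [], [(X1, X0, 8), (Ym1, X1, 4), (Z1, X1, 4), (Zm1, Ym1, 2), (V1, Z1, 2), (Vm1, Zm1, 1)]),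
           (1, [], [(Xm1, X0, 4), (Zm1, Xm1, 2), (Ym1, Zm1, 1), (Vm1, Zm1, 1)]),
           (1, [], [(Z0, X0, 4), (Y0, Z0, 2), (V0, Z0, 2), (Ym1, Y0, 1), (V1, V0, 1), (Vm1, V0, 1)])])
         (Split Y0 0
          (Leaf 17 [
            (2, [], [(X1, X0, 8), (Ym1, X1, 4), (Z1, X1, 4), (V1, Z1, 2), (Vm1, V1, 1)]),
            (2, [], [(Xm1, X0, 8), (Y1, Xm1, 4), (Zm1, Xm1, 4), (Ym1, Zm1, 2), (Vm1, Zm1, 2), (V1, Vm1, 1)]),
            (4, [], [(Z0, X0, 8), (V0, Z0, 4), (V1, V0, 2), (Vm1, V0, 2), (Z1, V1, 1), (Zm1, Vm1, 1)]),
            (1, [], [(X1, X0, 8), (Ym1, X1, 4), (Z1, X1, 4), (Zm1, Ym1, 2), (V1, Z1, 2), (Vm1, Zm1, 1)]),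
            (1, [], [(Xm1, X0, 8), (Y1, Xm1, 4), (Zm1, Xm1, 4), (Ym1, Zm1, 2), (Z1, Y1, 2), (Vm1, Zm1, 2), (V1, Z1, 1)])])
          (Split Ym1 0
           (Leaf 17 [
             (1, [], [(X1, X0, 8), (Z1, X1, 4), (Y1, Z1, 2), (V1, Z1, 2), (Vm1, V1, 1)]),
             (3, [], [(Xm1, X0, 8), (Zm1, Xm1, 4), (Vm1, Zm1, 2), (V1, Vm1, 1)]),
             (4, [], [(Z0, X0, 8), (V0, Z0, 4), (V1, V0, 2), (Vm1, V0, 2), (Z1, V1, 1), (Zm1, Vm1, 1)]),
             (1, [], [(X1, X0, 16), (Z1, X1, 8), (V1, Z1, 4), (V0, V1, 2), (Vm1, V1, 2), (Zm1, Vm1, 1)])])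
           (Split X1 0
            (Split Xm1 0
             (Split Vm1 3
              (Split Zm1 1
               (Split V1 3
                (Split Z1 1
                 (Split Ym1 1
                  (Split Z1 0
                   (Leaf 3 [
                     (1, [], [(Z0, X0, 8), (V0, Z0, 4), (V1, V0, 2), (Vm1, V0, 2), (Zm1, Vm1, 1)])])
                   (Split V1 1
                    (Leaf 1 [])
                    (Leaf 3 [
                      (1, [], [(Z0, X0, 8), (Y0, Z0, 4), (V0, Z0, 4), (V1, V0, 2), (Vm1, V0, 2), (Z1, V1, 1)]),
                      (1, [(V1, Z1), (Z1, Y1), (Y1, Xm1)], [(Xm1, X0, 4), (Zm1, Xm1, 2), (Vm1, Zm1, 1)])])))
                  (Leaf 2 [
                    (1, [(Ym1, X1)], [(X1, X0, 8), (Z1, X1, 4), (V1, Z1, 2), (Vm1, V1, 1)]),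
                    (1, [(Ym1, Y0)], [(Z0, X0, 4), (Y0, Z0, 2), (V0, Z0, 2), (Vm1, V0, 1)])]))
                 (Leaf 3 [
                   (1, [(Z1, X1)], [(X1, X0, 16), (Ym1, X1, 8), (Zm1, Ym1, 4), (Vm1, Zm1, 2), (V1, Vm1, 1)]),
                   (1, [(Z1, V1)], [(Z0, X0, 4), (V0, Z0, 2), (V1, V0, 1), (Vm1, V0, 1)])]))
                (Split Z1 0
                 (Leaf 4 [
                   (3, [], [(Z0, X0, 4), (Y0, Z0, 2), (V0, Z0, 2), (Ym1, Y0, 1), (V1, V0, 1), (Vm1, V0, 1)]),
                   (1, [(V1, Z1), (V1, Z1), (Z1, X1)], [(X1, X0, 16), (Ym1, X1, 8), (Zm1, Ym1, 4), (Vm1, Zm1, 2), (V1, Vm1, 1)])])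
                 (Leaf 4 [
                   (2, [], [(X1, X0, 8), (Ym1, X1, 4), (Z1, X1, 4), (Y1, Z1, 2), (V1, Z1, 2), (V0, V1, 1), (Vm1, V1, 1)]),
                   (1, [(V1, V0), (V1, V0)], [(Z0, X0, 4), (V0, Z0, 2), (Vm1, V0, 1)]),
                   (2, [(V1, Vm1), (V1, Z1), (Z1, X1)], [(X1, X0, 8), (Ym1, X1, 4), (Zm1, Ym1, 2), (Vm1, Zm1, 1)])])))
               (Leaf 5 [
                 (1, [], [(Z0, X0, 8), (Y0, Z0, 4), (V0, Z0, 4), (Y1, Y0, 2), (Ym1, Y0, 2), (V1, V0, 2), (Vm1, V0, 2), (Zm1, Ym1, 1)]),
                 (1, [], [(Xm1, X0, 8), (Y1, Xm1, 4), (Zm1, Xm1, 4), (Ym1, Zm1, 2), (Z1, Y1, 2), (Vm1, Zm1, 2), (V0, Vm1, 1), (V1, Z1, 1)]),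
                 (1, [(Zm1, Xm1)], [(Xm1, X0, 16), (Y1, Xm1, 8), (Z1, Y1, 4), (V1, Z1, 2), (Vm1, V1, 1)])]))
              (Split Zm1 0
               (Leaf 4 [
                 (2, [], [(Z0, X0, 4), (Y0, Z0, 2), (V0, Z0, 2), (Ym1, Y0, 1), (V1, V0, 1), (Vm1, V0, 1)]),
                 (1, [], [(Z0, X0, 4), (V0, Z0, 2), (Vm1, V0, 1)]),
                 (1, [(Vm1, Zm1), (Vm1, Zm1), (Zm1, Xm1)], [(Xm1, X0, 16), (Y1, Xm1, 8), (Z1, Y1, 4), (V1, Z1, 2), (Vm1, V1, 1)]),
                 (2, [(Vm1, V0), (Vm1, V0), (V0, Z0)], [(Z0, X0, 4), (Y0, Z0, 2), (Ym1, Y0, 1)])])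
               (Leaf 2 [
                 (1, [], [(Xm1, X0, 8), (Zm1, Xm1, 4), (Vm1, Zm1, 2), (V1, Vm1, 1)]),
                 (1, [(Vm1, Zm1), (Vm1, Zm1)], [(Xm1, X0, 4), (Zm1, Xm1, 2), (Ym1, Zm1, 1)]),
                 (1, [(Vm1, V0), (Vm1, V0)], [(Z0, X0, 4), (Y0, Z0, 2), (V0, Z0, 2), (Ym1, Y0, 1)]),
                 (1, [(Vm1, V1), (Vm1, Zm1), (Zm1, Xm1)], [(Xm1, X0, 8), (Y1, Xm1, 4), (Z1, Y1, 2), (V1, Z1, 1)])])))
             (Leaf 5 [
               (1, [], [(Xm1, X0, 8), (Y1, Xm1, 4), (Zm1, Xm1, 4), (Ym1, Zm1, 2), (Vm1, Zm1, 2), (V1, Vm1, 1)]),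
               (1, [], [(Xm1, X0, 16), (Y1, Xm1, 8), (Z1, Y1, 4), (V1, Z1, 2), (V0, V1, 1)]),
               (1, [], [(Z0, X0, 4), (Y0, Z0, 2), (V0, Z0, 2), (Ym1, Y0, 1), (V1, V0, 1), (Vm1, V0, 1)]),
               (1, [], [(Xm1, X0, 8), (Y1, Xm1, 4), (Zm1, Xm1, 4), (Ym1, Zm1, 2), (Z1, Y1, 2), (Vm1, Zm1, 2), (V0, Vm1, 1), (V1, Z1, 1)])]))
            (Leaf 6 [
              (1, [], [(X1, X0, 8), (Ym1, X1, 4), (Y0, Ym1, 2), (Zm1, Ym1, 2), (Vm1, Zm1, 1)]),
              (1, [], [(Xm1, X0, 8), (Y1, Xm1, 4), (Zm1, Xm1, 4), (Y0, Y1, 2), (Vm1, Zm1, 2), (V0, Vm1, 1), (V1, Vm1, 1)]),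
              (2, [], [(X1, X0, 8), (Ym1, X1, 4), (Z1, X1, 4), (Y1, Z1, 2), (V1, Z1, 2), (V0, V1, 1), (Vm1, V1, 1)]),
              (1, [], [(Z0, X0, 4), (Y0, Z0, 2), (V0, Z0, 2), (Ym1, Y0, 1), (V1, V0, 1), (Vm1, V0, 1)])])))))
        (Leaf 7 [
          (1, [], [(Z0, X0, 8), (Y0, Z0, 4), (V0, Z0, 4), (Y1, Y0, 2), (Ym1, Y0, 2), (V1, V0, 2), (Vm1, V0, 2), (Z1, Y1, 1), (Zm1, Ym1, 1)]),
          (1, [], [(Xm1, X0, 8), (Y1, Xm1, 4), (Zm1, Xm1, 4), (Y0, Y1, 2), (Z1, Y1, 2), (Vm1, Zm1, 2), (V1, Z1, 1)]),
          (1, [], [(Z0, X0, 8), (V0, Z0, 4), (V1, V0, 2), (Vm1, V0, 2), (Z1, V1, 1), (Zm1, Vm1, 1)]),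
          (1, [], [(X1, X0, 8), (Ym1, X1, 4), (Z1, X1, 4), (Zm1, Ym1, 2), (V1, Z1, 2), (Vm1, Zm1, 1)])]))
       (Leaf 8 [
         (2, [], [(Z0, X0, 8), (Y0, Z0, 4), (V0, Z0, 4), (Y1, Y0, 2), (Ym1, Y0, 2), (V1, V0, 2), (Vm1, V0, 2), (Z1, Y1, 1), (Zm1, Ym1, 1)]),
         (1, [], [(X1, X0, 8), (Ym1, X1, 4), (Z1, X1, 4), (Zm1, Ym1, 2), (V1, Z1, 2), (V0, V1, 1)]),
         (1, [], [(Xm1, X0, 8), (Y1, Xm1, 4), (Zm1, Xm1, 4), (Z1, Y1, 2), (Vm1, Zm1, 2), (V0, Vm1, 1)]),
         (1, [], [(Z0, X0, 8), (V0, Z0, 4), (V1, V0, 2), (Vm1, V0, 2), (Z1, V1, 1), (Zm1, Vm1, 1)])]))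
      (Leaf 16 [
        (2, [], [(Xm1, X0, 8), (Y1, Xm1, 4), (Zm1, Xm1, 4), (Z1, Y1, 2), (Vm1, Zm1, 2), (V0, Vm1, 1)]),
        (2, [], [(Z0, X0, 8), (Y0, Z0, 4), (V0, Z0, 4), (V1, V0, 2), (Vm1, V0, 2), (Z1, V1, 1)]),
        (1, [(Z1, X1)], [(X1, X0, 16), (Ym1, X1, 8), (Zm1, Ym1, 4), (Vm1, Zm1, 2), (V1, Vm1, 1)]),
        (3, [], [(X1, X0, 16), (Z1, X1, 8), (V1, Z1, 4), (V0, V1, 2), (Vm1, V1, 2), (Zm1, Vm1, 1)]),
        (1, [], [(X1, X0, 16), (Ym1, X1, 8), (Z1, X1, 8), (Zm1, Ym1, 4), (Vm1, Zm1, 2), (V0, Vm1, 1)])]))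
     (Leaf 12 [
       (1, [], [(Xm1, X0, 8), (Y1, Xm1, 4), (Zm1, Xm1, 4), (Ym1, Zm1, 2), (Vm1, Zm1, 2), (V1, Vm1, 1)]),
       (1, [], [(X1, X0, 8), (Ym1, X1, 4), (Z1, X1, 4), (Zm1, Ym1, 2), (V1, Z1, 2), (Vm1, Zm1, 1)]),
       (1, [], [(X1, X0, 8), (Ym1, X1, 4), (Y0, Ym1, 2), (Zm1, Ym1, 2), (Vm1, Zm1, 1)]),
       (2, [], [(X1, X0, 8), (Ym1, X1, 4), (Z1, X1, 4), (Y1, Z1, 2), (V1, Z1, 2), (V0, V1, 1), (Vm1, V1, 1)]),
       (1, [], [(Xm1, X0, 4), (Zm1, Xm1, 2), (Ym1, Zm1, 1), (Vm1, Zm1, 1)]),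
       (1, [], [(Z0, X0, 4), (Y0, Z0, 2), (V0, Z0, 2), (Ym1, Y0, 1), (V1, V0, 1), (Vm1, V0, 1)]),
       (2, [], [(Z0, X0, 8), (Y0, Z0, 4), (V0, Z0, 4), (Y1, Y0, 2), (Ym1, Y0, 2), (V1, V0, 2), (Vm1, V0, 2), (Zm1, Ym1, 1)])]))
    (Leaf 27 [
      (3, [], [(Xm1, X0, 8), (Y1, Xm1, 4), (Zm1, Xm1, 4), (Y0, Y1, 2), (Z1, Y1, 2), (Vm1, Zm1, 2), (V1, Z1, 1)]),
      (1, [], [(X1, X0, 8), (Ym1, X1, 4), (Y0, Ym1, 2), (Zm1, Ym1, 2), (Vm1, Zm1, 1)]),
      (4, [(Y0, Z0)], [(Z0, X0, 8), (V0, Z0, 4), (V1, V0, 2), (Vm1, V0, 2), (Z1, V1, 1)]),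
      (3, [(Y0, Ym1)], [(X1, X0, 8), (Ym1, X1, 4), (Z1, X1, 4), (V1, Z1, 2), (Vm1, V1, 1)]),
      (2, [], [(Z0, X0, 4), (Y0, Z0, 2), (V0, Z0, 2), (Ym1, Y0, 1), (V1, V0, 1), (Vm1, V0, 1)]),
      (2, [], [(Z0, X0, 8), (Y0, Z0, 4), (V0, Z0, 4), (Y1, Y0, 2), (Ym1, Y0, 2), (V1, V0, 2), (Vm1, V0, 2), (Zm1, Ym1, 1)]),
      (2, [], [(Xm1, X0, 8), (Y1, Xm1, 4), (Zm1, Xm1, 4), (Y0, Y1, 2), (Vm1, Zm1, 2), (V1, Vm1, 1)]),
      (3, [], [(X1, X0, 4), (Ym1, X1, 2), (Z1, X1, 2), (Y0, Ym1, 1), (Y1, Z1, 1), (Zm1, Ym1, 1), (V1, Z1, 1)])]))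
   (Leaf 72 [
     (16, [], [(Z0, X0, 8), (Y0, Z0, 4), (V0, Z0, 4), (Y1, Y0, 2), (Ym1, Y0, 2), (V1, V0, 2), (Vm1, V0, 2), (Z1, Y1, 1), (Zm1, Ym1, 1)]),
     (2, [], [(X1, X0, 8), (Z1, X1, 4), (Y1, Z1, 2), (V1, Z1, 2), (Vm1, V1, 1)]),
     (3, [], [(Xm1, X0, 8), (Y1, Xm1, 4), (Zm1, Xm1, 4), (Y0, Y1, 2), (Z1, Y1, 2), (Vm1, Zm1, 2), (V1, Z1, 1)]),
     (1, [], [(Xm1, X0, 16), (Y1, Xm1, 8), (Z1, Y1, 4), (V1, Z1, 2), (V0, V1, 1)]),
     (10, [], [(X1, X0, 8), (Ym1, X1, 4), (Z1, X1, 4), (Y1, Z1, 2), (V1, Z1, 2), (V0, V1, 1), (Vm1, V1, 1)]),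
     (11, [(Y1, Xm1)], [(Xm1, X0, 8), (Zm1, Xm1, 4), (Vm1, Zm1, 2), (V0, Vm1, 1), (V1, Vm1, 1)]),
     (1, [(Y1, Y0)], [(Z0, X0, 4), (Y0, Z0, 2), (V0, Z0, 2), (V1, V0, 1)])])"

section \<open>Evaluation of the certificates\<close>

text \<open>The condition is a finite computation on closed terms; \<open>code_simp\<close> carries
  it out by rewriting with the code equations, so the result is an ordinary proved theorem.\<close>

lemma refutes_V0: "refutes J3_adj J3_list V0 12 (\<lambda>_. 0) ((\<lambda>_. 12)(V0 := 0)) cert_V0"
  by code_simp

lemma refutes_Z0: "refutes J3_adj J3_list Z0 12 (\<lambda>_. 0) ((\<lambda>_. 12)(Z0 := 0)) cert_Z0"
  by code_simp

lemma refutes_X0: "refutes J3_adj J3_list X0 12 (\<lambda>_. 0) ((\<lambda>_. 12)(X0 := 0)) cert_X0"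
  by code_simp

text \<open>The three certified roots represent all orbits of \<open>rot\<close>. Repeated rotation
  leads from \<open>V0\<close> to \<open>V1\<close> and \<open>Vm1\<close>, from \<open>Z0\<close>
  to \<open>Z1\<close> and \<open>Zm1\<close>, and from \<open>X0\<close> through \<open>X1\<close>,
  \<open>Ym1\<close>, \<open>Y0\<close>, \<open>Y1\<close> to \<open>Xm1\<close>.\<close>

lemma J3_solvable:
  assumes "size_config J3_V C = 12"
  shows "solvable J3_V J3_adj C r"
proof -
  have base: "solvable J3_V J3_adj C r"
    if "refutes J3_adj J3_list r 12 (\<lambda>_. 0) ((\<lambda>_. 12)(r := 0)) c" "size_config J3_V C = 12" for r c C
    using refutes_imp_solvable[OF that(1) J3_list J3_adj_irrefl _ that(2)] by (simp add: J3_V_UNIV)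
  note v = base[OF refutes_V0] and z = base[OF refutes_Z0] and x = base[OF refutes_X0]
  note rot = J3_solvable_rot[where n = 12]
  note v1 = rot[OF v, simplified] and z1 = rot[OF z, simplified] and x1 = rot[OF x, simplified]
  note v2 = rot[OF v1, simplified] and z2 = rot[OF z1, simplified] and x2 = rot[OF x1, simplified]
  note x3 = rot[OF x2, simplified]
  note x4 = rot[OF x3, simplified]
  note x5 = rot[OF x4, simplified]
  show ?thesis
    using assms v z x v1 z1 x1 v2 z2 x2 x3 x4 x5 by (cases r) simp_all
qed

section \<open>The pebbling number of \<open>J3\<close>\<close>

theorem theorem1:
  shows "card J3_V = 12 \<and> pebbling_number J3_V J3_adj = card J3_V"
proof -
  have "pebbling_number J3_V J3_adj = 12"
    unfolding pebbling_number_def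
  proof (rule Least_equality)
    show "\<forall>r\<in>J3_V. \<forall>C. is_config J3_V C \<and> size_config J3_V C = 12 \<longrightarrow> solvable J3_V J3_adj C r"
      using J3_solvable by blast
  next
    fix t
    assume t: "\<forall>r\<in>J3_V. \<forall>C. is_config J3_V C \<and> size_config J3_V C = t \<longrightarrow> solvable J3_V J3_adj C r"
    show "12 \<le> t"
    \<comment> \<open>The defining property of the pebbling number concerns exactly \<open>t\<close>
      pebbles and is not presupposed to pass to larger numbers, so every \<open>t\<close> below 12,
      not just 11, receives its own unsolvable configuration.\<close>
    proof (rule ccontr)
      assume "\<not> 12 \<le> t"
      moreover have "finite J3_V" "V0 \<in> J3_V"
        by (simp_all add: J3_V_def)
      ultimately obtain C where "is_config J3_V C" "size_config J3_V C = t" "\<not> solvable J3_V J3_adj C V0"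
        using unsolvable_of_less_card[of J3_V V0 t J3_adj] by (auto simp: card_J3_V)
      then show False
        using t \<open>V0 \<in> J3_V\<close> by blast
    qed
  qed
  then show ?thesis
    by (simp add: card_J3_V)
qed

end
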